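(* Let $A <_T \emptyset'$ be a set that is not $K$-trivial, and let $D \le_T \emptyset'$ be a non-computable set. Then there exists a Martin-L\"of random set $R$ such that (1) $R \not\ge_T D$; (2) $R$ is low, i.e., $R' \le_T \emptyset'$; (3) $A \oplus R \equiv_T \emptyset'$.
   Context: $K$ denotes prefix-free Kolmogorov complexity, with $K(n)=K(1^n)$. A set $A$ is $K$-trivial if there is a constant $c$ such that $K(A\upharpoonright n) \le K(n) + c$ for all $n$. A set $R$ is Martin-L\"of random if there is a constant $c$ such that $K(R\upharpoonright n) > n-c$ for all $n$. *)

theory Defs
  imports "HOL-Library.Nat_Bijection" "HOL-Library.Extended_Nat" "HOL-Library.Sublist"
begin

section \<open>Computation relative to an oracle\<close>

text \<open>
  Programs denote unary partial functions on the naturals; several arguments are passed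
  through the pairing function \<^const>\<open>prod_encode\<close>.
\<close>

datatype prog =
    PZero
  | PSucc
  | PFst
  | PSnd
  | PQuery
  | PPair prog prog
  | PComp prog prog
  | PRec prog prog
  | PMin prog

text \<open>
  \<open>computes A p x y\<close>: program \<open>p\<close> with oracle \<open>A\<close> halts on input \<open>x\<close> with output \<open>y\<close>.
  \<open>PRec\<close> is primitive recursion with parameter \<open>a\<close>.  \<open>PMin\<close> is unbounded minimisation:
  all values below the least zero have to be defined.
\<close>

inductive computes :: "nat set \<Rightarrow> prog \<Rightarrow> nat \<Rightarrow> nat \<Rightarrow> bool" for A :: "nat set" where
  zero: "computes A PZero x 0"
| succ: "computes A PSucc x (Suc x)"
| fst: "computes A PFst (prod_encode (x, y)) x"
| snd: "computes A PSnd (prod_encode (x, y)) y"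
| query: "computes A PQuery x (of_bool (x \<in> A))"
| pair: "computes A f x y \<Longrightarrow> computes A g x z \<Longrightarrow> computes A (PPair f g) x (prod_encode (y, z))"
| comp: "computes A g x y \<Longrightarrow> computes A f y z \<Longrightarrow> computes A (PComp f g) x z"
| rec_0: "computes A f a y \<Longrightarrow> computes A (PRec f g) (prod_encode (a, 0)) y"
| rec_Suc: "computes A (PRec f g) (prod_encode (a, n)) r \<Longrightarrow>
    computes A g (prod_encode (a, prod_encode (n, r))) y \<Longrightarrow>
    computes A (PRec f g) (prod_encode (a, Suc n)) y"
| min: "computes A f (prod_encode (a, n)) 0 \<Longrightarrow>
    (\<And>m. m < n \<Longrightarrow> \<exists>y. computes A f (prod_encode (a, m)) (Suc y)) \<Longrightarrow>
    computes A (PMin f) a n"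

lemma computes_deterministic:
  "computes A p x y \<Longrightarrow> computes A p x z \<Longrightarrow> y = z"
proof (induction arbitrary: z rule: computes.induct)
  case (pair f x y g z)
  from pair.prems show ?case by cases (auto dest: pair.IH)
next
  case (comp g x y f z)
  from comp.prems show ?case by cases (auto dest: comp.IH)
next
  case (rec_0 f a y g)
  from rec_0.prems show ?case by cases (auto dest: rec_0.IH)
next
  case (rec_Suc f g a n r y)
  from rec_Suc.prems show ?case by cases (auto dest!: rec_Suc.IH)
next
  case (min f a n)
  from min.prems show ?case
  proof cases
    case min
    then show ?thesis
      using min.IH by (metis linorder_neqE_nat nat.distinct(1))
  qed
qed (auto elim: computes.cases)

text \<open>An effective numbering of programs; numbers outside its range index no program.\<close>

primrec prog_index :: "prog \<Rightarrow> nat" where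
  "prog_index PZero = prod_encode (0, 0)"
| "prog_index PSucc = prod_encode (1, 0)"
| "prog_index PFst = prod_encode (2, 0)"
| "prog_index PSnd = prod_encode (3, 0)"
| "prog_index PQuery = prod_encode (4, 0)"
| "prog_index (PPair f g) = prod_encode (5, prod_encode (prog_index f, prog_index g))"
| "prog_index (PComp f g) = prod_encode (6, prod_encode (prog_index f, prog_index g))"
| "prog_index (PRec f g) = prod_encode (7, prod_encode (prog_index f, prog_index g))"
| "prog_index (PMin f) = prod_encode (8, prog_index f)"

lemma inj_prog_index: "inj prog_index"
proof (rule injI)
  fix p q
  show "prog_index p = prog_index q \<Longrightarrow> p = q"
  proof (induction p arbitrary: q)
    case PZero then show ?case by (cases q) auto
  next
    case PSucc then show ?case by (cases q) auto
  next
    case PFst then show ?case by (cases q) auto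
  next
    case PSnd then show ?case by (cases q) auto
  next
    case PQuery then show ?case by (cases q) auto
  next
    case PPair then show ?case by (cases q) auto
  next
    case PComp then show ?case by (cases q) auto
  next
    case PRec then show ?case by (cases q) auto
  next
    case PMin then show ?case by (cases q) auto
  qed
qed

section \<open>Turing reducibility, join and jump\<close>

definition turing_le :: "nat set \<Rightarrow> nat set \<Rightarrow> bool"  (infix \<open>\<le>\<^sub>T\<close> 50) where
  "A \<le>\<^sub>T B \<longleftrightarrow> (\<exists>p. \<forall>n. computes B p n (of_bool (n \<in> A)))"

definition turing_less :: "nat set \<Rightarrow> nat set \<Rightarrow> bool"  (infix \<open><\<^sub>T\<close> 50) where
  "A <\<^sub>T B \<longleftrightarrow> A \<le>\<^sub>T B \<and> \<not> B \<le>\<^sub>T A"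

definition turing_equiv :: "nat set \<Rightarrow> nat set \<Rightarrow> bool"  (infix \<open>\<equiv>\<^sub>T\<close> 50) where
  "A \<equiv>\<^sub>T B \<longleftrightarrow> A \<le>\<^sub>T B \<and> B \<le>\<^sub>T A"

definition computable :: "nat set \<Rightarrow> bool" where
  "computable A \<longleftrightarrow> A \<le>\<^sub>T {}"

definition turing_join :: "nat set \<Rightarrow> nat set \<Rightarrow> nat set"  (infixl \<open>\<oplus>\<^sub>T\<close> 65) where
  "A \<oplus>\<^sub>T B = {2 * n | n. n \<in> A} \<union> {2 * n + 1 | n. n \<in> B}"

definition jump :: "nat set \<Rightarrow> nat set" where
  "jump A = {e. \<exists>p y. prog_index p = e \<and> computes A p e y}"

definition low :: "nat set \<Rightarrow> bool" where
  "low A \<longleftrightarrow> jump A \<le>\<^sub>T jump {}"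

section \<open>Prefix-free Kolmogorov complexity\<close>

type_synonym bitstring = "bool list"

definition bitstring_code :: "bitstring \<Rightarrow> nat" where
  "bitstring_code \<sigma> = list_encode (map of_bool \<sigma>)"

definition partial_computable :: "(bitstring \<Rightarrow> bitstring option) \<Rightarrow> bool" where
  "partial_computable M \<longleftrightarrow>
    (\<exists>p. \<forall>\<sigma> y. computes {} p (bitstring_code \<sigma>) y \<longleftrightarrow>
      (\<exists>\<tau>. M \<sigma> = Some \<tau> \<and> y = bitstring_code \<tau>))"

definition prefix_free_machine :: "(bitstring \<Rightarrow> bitstring option) \<Rightarrow> bool" where
  "prefix_free_machine M \<longleftrightarrow> partial_computable M \<and>
    (\<forall>\<sigma>\<in>dom M. \<forall>\<tau>\<in>dom M. prefix \<sigma> \<tau> \<longrightarrow> \<sigma> = \<tau>)"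

text \<open>The value is \<open>\<infinity>\<close> if \<open>M\<close> never outputs \<open>\<sigma>\<close>.\<close>

definition K :: "(bitstring \<Rightarrow> bitstring option) \<Rightarrow> bitstring \<Rightarrow> enat" where
  "K M \<sigma> = (INF \<rho>\<in>{\<rho>. M \<rho> = Some \<sigma>}. enat (length \<rho>))"

text \<open>
  Prefix-free Kolmogorov complexity is \<open>K U\<close> for an optimal \<open>U\<close>; different optimal machines
  give the same function up to an additive constant.
\<close>

definition optimal_prefix_free_machine :: "(bitstring \<Rightarrow> bitstring option) \<Rightarrow> bool" where
  "optimal_prefix_free_machine U \<longleftrightarrow> prefix_free_machine U \<and>
    (\<forall>M. prefix_free_machine M \<longrightarrow> (\<exists>c::nat. \<forall>\<sigma>. K U \<sigma> \<le> K M \<sigma> + enat c))"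

definition initial_segment :: "nat set \<Rightarrow> nat \<Rightarrow> bitstring"  (infix \<open>\<restriction>\<close> 80) where
  "A \<restriction> n = map (\<lambda>i. i \<in> A) [0..<n]"

definition K_trivial :: "(bitstring \<Rightarrow> bitstring option) \<Rightarrow> nat set \<Rightarrow> bool" where
  "K_trivial U A \<longleftrightarrow>
    (\<exists>c::nat. \<forall>n. K U (A \<restriction> n) \<le> K U (replicate n True) + enat c)"

text \<open>The bound \<open>K(R \<restriction> n) > n - c\<close>, without truncated subtraction.\<close>

definition Martin_Loef_random :: "(bitstring \<Rightarrow> bitstring option) \<Rightarrow> nat set \<Rightarrow> bool" where
  "Martin_Loef_random U R \<longleftrightarrow> (\<exists>c::nat. \<forall>n. K U (R \<restriction> n) + enat c > enat n)"

end

theory Submission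
  imports Defs Complex_Main
begin

text \<open>
  Fix for each \<open>m\<close> the \<open>A\<close>-c.e. open set \<open>V\<^sub>m\<close> of all \<open>X\<close> that, for some \<open>\<rho>\<close> and \<open>n\<close> with \<open>U(\<rho>) = 1\<^sup>n\<close>,
  vanish on a block of \<open>|\<rho>| + m\<close> positions reserved for \<open>(\<rho>, A \<restriction> n)\<close>.  Its measure is at most
  \<open>1 / 2 ^ m\<close>.  If a \<open>\<Pi>\<^sup>0\<^sub>1\<close> class of positive measure were disjoint from \<open>V\<^sub>m\<close>, then the requests
  \<open>(\<rho>, \<tau>)\<close> whose block no member of the class avoids would be c.e. and, by independence of the
  blocks, of finite weight, so that \<open>A\<close> would be \<open>K\<close>-trivial by Kraft-Chaitin.  Hence every such class
  meets \<open>V\<^sub>m\<close>.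

  A construction computable in the halting problem forces with \<open>\<Pi>\<^sup>0\<^sub>1\<close> classes of random sets together
  with a lower bound \<open>1 / 2 ^ q\<close> of their measure.  Forcing a bit of the jump, or a difference between
  \<open>D\<close> and a functional, costs a constant factor.  To code the \<open>k\<close>-th bit of the halting problem, the
  set is kept out of \<open>V\<^sub>q\<^sub>+\<^sub>4\<close> until this bit has settled and then enters it by a string of length \<open>L\<close>;
  passing to the points of high density first ensures that the new class has measure at least
  \<open>1 / 2 ^ (q + 5 + L)\<close>.  As the new bound depends only on \<open>q\<close> and \<open>L\<close>, the join of \<open>A\<close> and the set
  built can recover the sequence of entry lengths.
\<close>

section \<open>Closure properties of the computable functions\<close>

text \<open>The obstacle in coding is that the decoder sees only \<open>A\<close> and
  \<open>R\<close>, never the conditions, which depend on \<open>D\<close> and on undecidable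
  choices. So every step charges the same worst-case factor whichever way it is decided. Wrong
  guesses are part of the design: a request carries an arbitrary string where
  \<open>A \<restriction> n\<close> is meant. The requests missed by a class can thus be enumerated
  without \<open>A\<close>, and independence bounds the weight of all of them, right or wrong.
  Meeting the open set is not enough by itself, since the part of the class beyond the entry string
  could be null. The dense core is again an effectively closed class of positive measure, so the
  meeting argument applies to it, and every string extendible in it keeps a definite measure. The
  open set is only c.e. in \<open>A\<close>, but removing one finite stage of it removes a clopen
  set, so the class stays effectively closed without an oracle. Measures occur only as finite
  counts: a class is a decreasing sequence of clopen sets, and a lower bound is demanded at every
  level.\<close>

abbreviation pfst :: "nat \<Rightarrow> nat" where "pfst z \<equiv> fst (prod_decode z)"
abbreviation psnd :: "nat \<Rightarrow> nat" where "psnd z \<equiv> snd (prod_decode z)"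
abbreviation npair :: "nat \<Rightarrow> nat \<Rightarrow> nat"  (\<open>\<langle>_,/ _\<rangle>\<close>) where "\<langle>x, y\<rangle> \<equiv> prod_encode (x, y)"

text \<open>Programs are hidden behind \<open>recf\<close> and \<open>dec\<close> so that
  computability proofs become syntax-directed through \<open>recf_intros\<close>; a bound variable
  is handled by pairing it with the outer argument.\<close>

definition recf :: "nat set \<Rightarrow> (nat \<Rightarrow> nat) \<Rightarrow> bool" where
  "recf A f \<longleftrightarrow> (\<exists>p. \<forall>x. computes A p x (f x))"

definition dec :: "nat set \<Rightarrow> (nat \<Rightarrow> bool) \<Rightarrow> bool" where
  "dec A P \<longleftrightarrow> recf A (\<lambda>x. of_bool (P x))"

named_theorems recf_intros

lemma turing_le_iff_dec: "B \<le>\<^sub>T A \<longleftrightarrow> dec A (\<lambda>x. x \<in> B)"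
  by (simp add: turing_le_def dec_def recf_def)

lemma computes_pfst: "computes A PFst z (pfst z)"
  by (metis computes.fst prod.collapse prod_decode_inverse)

lemma computes_psnd: "computes A PSnd z (psnd z)"
  by (metis computes.snd prod.collapse prod_decode_inverse)

lemma computes_PComp_iff: "computes A (PComp f g) x z \<longleftrightarrow> (\<exists>y. computes A g x y \<and> computes A f y z)"
  by (auto intro: computes.comp elim: computes.cases[of A "PComp f g" x z])

lemma computes_PMin_iff:
  "computes A (PMin f) a n \<longleftrightarrow> computes A f \<langle>a, n\<rangle> 0 \<and> (\<forall>m<n. \<exists>y. computes A f \<langle>a, m\<rangle> (Suc y))"
  by (auto intro: computes.min elim: computes.cases)

lemma recf_comp: "recf A f \<Longrightarrow> recf A g \<Longrightarrow> recf A (\<lambda>x. f (g x))"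
  unfolding recf_def by (metis computes.comp)

text \<open>There is no identity primitive, but every number codes a pair and can be rebuilt from
  its projections.\<close>

lemma recf_id [recf_intros]: "recf A (\<lambda>x. x)"
  unfolding recf_def
proof (intro exI allI)
  show "computes A (PPair PFst PSnd) x x" for x
    using computes.pair[OF computes_pfst[of A x] computes_psnd[of A x]] by simp
qed

lemma recf_Suc [recf_intros]: "recf A f \<Longrightarrow> recf A (\<lambda>x. Suc (f x))"
  unfolding recf_def by (metis computes.comp computes.succ)

lemma recf_const [recf_intros]: "recf A (\<lambda>x. c)"
proof (induction c)
  case 0
  show ?case unfolding recf_def by (intro exI allI) (rule computes.zero)
next
  case (Suc c)
  then show ?case by (rule recf_Suc)
qed

lemma recf_npair [recf_intros]: "recf A f \<Longrightarrow> recf A g \<Longrightarrow> recf A (\<lambda>x. \<langle>f x, g x\<rangle>)"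
  unfolding recf_def by (metis computes.pair)

lemma recf_pfst [recf_intros]: "recf A f \<Longrightarrow> recf A (\<lambda>x. pfst (f x))"
  unfolding recf_def by (metis computes.comp computes_pfst)

lemma recf_psnd [recf_intros]: "recf A f \<Longrightarrow> recf A (\<lambda>x. psnd (f x))"
  unfolding recf_def by (metis computes.comp computes_psnd)

lemma dec_oracle: "recf A f \<Longrightarrow> dec A (\<lambda>x. f x \<in> A)"
  unfolding recf_def dec_def by (metis computes.comp computes.query)

lemma recf_comp2:
  assumes "recf A (\<lambda>z. F (pfst z) (psnd z))" "recf A f" "recf A g"
  shows "recf A (\<lambda>x. F (f x) (g x))"
  using recf_comp[OF assms(1) recf_npair[OF assms(2,3)]] by simp

lemma recf_rec_nat [recf_intros]:
  assumes "recf A f"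
    and "recf A (\<lambda>z. G (pfst z) (pfst (psnd z)) (psnd (psnd z)))"
    and "recf A h"
  shows "recf A (\<lambda>x. rec_nat (f x) (G x) (h x))"
proof -
  from assms obtain p q where p: "\<And>x. computes A p x (f x)"
    and q: "\<And>z. computes A q z (G (pfst z) (pfst (psnd z)) (psnd (psnd z)))"
    unfolding recf_def by metis
  have "computes A (PRec p q) \<langle>x, n\<rangle> (rec_nat (f x) (G x) n)" for x n
  proof (induction n)
    case 0
    show ?case using p by (auto intro: computes.rec_0)
  next
    case (Suc n)
    show ?case
      using q[of "\<langle>x, \<langle>n, rec_nat (f x) (G x) n\<rangle>\<rangle>"] by (auto intro: computes.rec_Suc[OF Suc])
  qed
  then have "recf A (\<lambda>z. rec_nat (f (pfst z)) (G (pfst z)) (psnd z))"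
    unfolding recf_def by (metis prod.collapse prod_decode_inverse)
  from recf_comp2[where F = "\<lambda>x n. rec_nat (f x) (G x) n", OF this recf_id assms(3)] show ?thesis .
qed

lemma recf_dec [recf_intros]: "dec A P \<Longrightarrow> recf A (\<lambda>x. of_bool (P x))"
  by (simp add: dec_def)


lemma dec_comp2:
  assumes "dec A (\<lambda>z. F (pfst z) (psnd z))" "recf A f" "recf A g"
  shows "dec A (\<lambda>x. F (f x) (g x))"
  using assms recf_comp2[where F = "\<lambda>x y. of_bool (F x y)"] by (simp add: dec_def)

lemma dec_comp:
  assumes "dec A F" "recf A f"
  shows "dec A (\<lambda>x. F (f x))"
  using assms recf_comp[where f = "\<lambda>x. of_bool (F x)"] by (simp add: dec_def)

section \<open>Arithmetic by primitive recursion\<close>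

lemma recf_pred: "recf A f \<Longrightarrow> recf A (\<lambda>x. f x - 1)"
proof -
  assume f: "recf A f"
  have "recf A (\<lambda>x. rec_nat 0 (\<lambda>n r. n) (f x))"
    by (intro recf_intros f)
  moreover have "rec_nat 0 (\<lambda>n r. n) m = m - 1" for m :: nat
    by (cases m) auto
  ultimately show ?thesis by simp
qed

lemma recf_add [recf_intros]: "recf A f \<Longrightarrow> recf A g \<Longrightarrow> recf A (\<lambda>x. f x + g x)"
proof -
  assume fg: "recf A f" "recf A g"
  have "recf A (\<lambda>x. rec_nat (f x) (\<lambda>n r. Suc r) (g x))"
    by (intro recf_intros fg)
  moreover have "rec_nat a (\<lambda>n r. Suc r) m = a + m" for a m :: nat
    by (induction m) auto
  ultimately show ?thesis by simp
qed

lemma recf_diff [recf_intros]: "recf A f \<Longrightarrow> recf A g \<Longrightarrow> recf A (\<lambda>x. f x - g x)"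
proof -
  assume fg: "recf A f" "recf A g"
  have "recf A (\<lambda>x. rec_nat (f x) (\<lambda>n r. r - 1) (g x))"
    by (intro recf_intros recf_pred fg)
  moreover have "rec_nat a (\<lambda>n r. r - 1) m = a - m" for a m :: nat
    by (induction m) auto
  ultimately show ?thesis by simp
qed

lemma recf_mult [recf_intros]: "recf A f \<Longrightarrow> recf A g \<Longrightarrow> recf A (\<lambda>x. f x * g x)"
proof -
  assume fg: "recf A f" "recf A g"
  have "recf A (\<lambda>x. rec_nat 0 (\<lambda>n r. r + f x) (g x))"
    by (intro recf_intros recf_comp[OF fg(1)] fg)
  moreover have "rec_nat 0 (\<lambda>n r. r + a) m = a * m" for a m :: nat
    by (induction m) auto
  ultimately show ?thesis by simp
qed

lemma recf_power [recf_intros]: "recf A f \<Longrightarrow> recf A g \<Longrightarrow> recf A (\<lambda>x. f x ^ g x)"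
proof -
  assume fg: "recf A f" "recf A g"
  have "recf A (\<lambda>x. rec_nat 1 (\<lambda>n r. r * f x) (g x))"
    by (intro recf_intros recf_comp[OF fg(1)] fg)
  moreover have "rec_nat 1 (\<lambda>n r. r * a) m = a ^ m" for a m :: nat
    by (induction m) auto
  ultimately show ?thesis by simp
qed

lemma recf_sum [recf_intros]:
  assumes F: "recf A (\<lambda>z. F (pfst z) (psnd z))" and h: "recf A h"
  shows "recf A (\<lambda>x. \<Sum>i<h x. F x i)"
proof -
  have "recf A (\<lambda>x. rec_nat 0 (\<lambda>n r. r + F x n) (h x))"
    by (intro recf_intros h recf_comp2[OF F])
  moreover have "rec_nat 0 (\<lambda>n r. r + F x n) m = (\<Sum>i<m. F x i)" for x m
    by (induction m) auto
  ultimately show ?thesis by simp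
qed

lemma recf_If [recf_intros]:
  assumes "dec A P" "recf A f" "recf A g"
  shows "recf A (\<lambda>x. if P x then f x else g x)"
proof -
  have "recf A (\<lambda>x. of_bool (P x) * f x + (1 - of_bool (P x)) * g x)"
    by (intro recf_intros assms)
  moreover have "of_bool (P x) * f x + (1 - of_bool (P x)) * g x = (if P x then f x else g x)" for x
    by simp
  ultimately show ?thesis by simp
qed

section \<open>Decidable predicates and bounded quantifiers\<close>

lemma dec_const [recf_intros]: "dec A (\<lambda>x. P)"
  unfolding dec_def by (intro recf_intros)

lemma dec_not [recf_intros]: "dec A P \<Longrightarrow> dec A (\<lambda>x. \<not> P x)"
proof -
  assume "dec A P"
  then have "recf A (\<lambda>x. 1 - of_bool (P x))" by (intro recf_intros)
  moreover have "1 - of_bool (P x) = (of_bool (\<not> P x) :: nat)" for x by simp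
  ultimately show ?thesis by (simp add: dec_def)
qed

lemma dec_conj [recf_intros]: "dec A P \<Longrightarrow> dec A Q \<Longrightarrow> dec A (\<lambda>x. P x \<and> Q x)"
proof -
  assume "dec A P" "dec A Q"
  then have "recf A (\<lambda>x. of_bool (P x) * of_bool (Q x))" by (intro recf_intros)
  then show ?thesis by (simp add: dec_def of_bool_conj)
qed

lemma dec_disj [recf_intros]: "dec A P \<Longrightarrow> dec A Q \<Longrightarrow> dec A (\<lambda>x. P x \<or> Q x)"
  using dec_not[of A "\<lambda>x. \<not> P x \<and> \<not> Q x"] by (simp add: dec_conj dec_not)

lemma dec_imp [recf_intros]: "dec A P \<Longrightarrow> dec A Q \<Longrightarrow> dec A (\<lambda>x. P x \<longrightarrow> Q x)"
  unfolding imp_conv_disj by (intro dec_disj dec_not)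

lemma dec_le [recf_intros]: "recf A f \<Longrightarrow> recf A g \<Longrightarrow> dec A (\<lambda>x. f x \<le> g x)"
proof -
  assume "recf A f" "recf A g"
  then have "recf A (\<lambda>x. 1 - (f x - g x))" by (intro recf_intros)
  moreover have "1 - (a - b) = of_bool (a \<le> b)" for a b :: nat by simp
  ultimately show ?thesis by (simp add: dec_def)
qed

lemma dec_less [recf_intros]: "recf A f \<Longrightarrow> recf A g \<Longrightarrow> dec A (\<lambda>x. f x < g x)"
  using dec_not[OF dec_le, of A g f] by (simp add: not_le)

lemma dec_eq [recf_intros]: "recf A f \<Longrightarrow> recf A g \<Longrightarrow> dec A (\<lambda>x. f x = g x)"
  using dec_conj[OF dec_le dec_le, of A f g g f] by (simp add: eq_iff)

lemma dec_iff [recf_intros]: "dec A P \<Longrightarrow> dec A Q \<Longrightarrow> dec A (\<lambda>x. P x = Q x)"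
  using dec_conj[OF dec_imp dec_imp, of A P Q Q P] by (simp add: iff_conv_conj_imp)

lemma dec_ball_less [recf_intros]:
  assumes P: "dec A (\<lambda>z. P (pfst z) (psnd z))" and h: "recf A h"
  shows "dec A (\<lambda>x. \<forall>i<h x. P x i)"
proof -
  have "dec A (\<lambda>x. (\<Sum>i<h x. 1 - of_bool (P x i)) = (0::nat))"
    by (intro recf_intros h P)
  moreover have "(\<Sum>i<n. 1 - of_bool (P x i)) = (0::nat) \<longleftrightarrow> (\<forall>i<n. P x i)" for n x
    by (auto simp: sum_eq_0_iff not_le split: if_splits)
  ultimately show ?thesis by simp
qed

lemma dec_bex_less [recf_intros]:
  assumes P: "dec A (\<lambda>z. P (pfst z) (psnd z))" and h: "recf A h"
  shows "dec A (\<lambda>x. \<exists>i<h x. P x i)"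
  using dec_not[OF dec_ball_less[OF dec_not[OF P] h]] by simp

lemma dec_ball_le [recf_intros]:
  assumes P: "dec A (\<lambda>z. P (pfst z) (psnd z))" and h: "recf A h"
  shows "dec A (\<lambda>x. \<forall>i\<le>h x. P x i)"
  using dec_ball_less[OF P recf_Suc[OF h]] by (simp add: less_Suc_eq_le)

lemma dec_bex_le [recf_intros]:
  assumes P: "dec A (\<lambda>z. P (pfst z) (psnd z))" and h: "recf A h"
  shows "dec A (\<lambda>x. \<exists>i\<le>h x. P x i)"
  using dec_bex_less[OF P recf_Suc[OF h]] by (simp add: less_Suc_eq_le)

text \<open>The equivalence also describes divergence: without a witness no value is computed. Both
  the reduction to the halting problem and the Kraft-Chaitin machine rely on this.\<close>

lemma dec_search_program:
  assumes "dec A (\<lambda>z. P (pfst z) (psnd z))"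
  shows "\<exists>p. \<forall>x n. computes A p x n \<longleftrightarrow> P x n \<and> (\<forall>m<n. \<not> P x m)"
proof -
  have "recf A (\<lambda>z. 1 - of_bool (P (pfst z) (psnd z)))" by (intro recf_intros assms)
  then obtain p where p: "\<And>z. computes A p z (1 - of_bool (P (pfst z) (psnd z)))"
    unfolding recf_def by metis
  have p': "computes A p z y \<longleftrightarrow> y = 1 - of_bool (P (pfst z) (psnd z))" for y z
    using p computes_deterministic by blast
  have "computes A (PMin p) x n \<longleftrightarrow> P x n \<and> (\<forall>m<n. \<not> P x m)" for x n
    by (auto simp: computes_PMin_iff p' split: if_splits)
  then show ?thesis by blast
qed

lemma recf_Least:
  assumes "dec A (\<lambda>z. P (pfst z) (psnd z))" and ex: "\<And>x. \<exists>n. P x n"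
  shows "recf A (\<lambda>x. LEAST n. P x n)"
proof -
  from dec_search_program[OF assms(1)]
  obtain p where p: "\<And>x n. computes A p x n \<longleftrightarrow> P x n \<and> (\<forall>m<n. \<not> P x m)" by blast
  have "computes A p x (LEAST n. P x n)" for x
    using LeastI_ex[OF ex] not_less_Least by (auto simp: p)
  then show ?thesis unfolding recf_def by blast
qed

lemma recf_div [recf_intros]:
  assumes f: "recf A f" and g: "recf A g"
  shows "recf A (\<lambda>x. f x div g x)"
proof -
  \<comment> \<open>The disjunct \<open>g x = 0\<close> keeps the search total and makes it return
    \<open>0\<close>, the value of division by zero.\<close>
  have "recf A (\<lambda>x. LEAST q. g x = 0 \<or> f x < Suc q * g x)"
  proof (rule recf_Least)
    show "dec A (\<lambda>z. g (pfst z) = 0 \<or> f (pfst z) < Suc (psnd z) * g (pfst z))"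
      by (intro recf_intros recf_comp[OF f] recf_comp[OF g])
    show "\<exists>q. g x = 0 \<or> f x < Suc q * g x" for x
    proof (cases "g x = 0")
      case False
      then have "Suc (f x) * 1 \<le> Suc (f x) * g x" by (intro mult_le_mono2) simp
      then have "f x < Suc (f x) * g x" by (simp only: mult_1_right Suc_le_eq)
      then show ?thesis by blast
    qed simp
  qed
  moreover have "(LEAST q. b = 0 \<or> a < Suc q * b) = a div b" for a b :: nat
  proof (cases "b = 0")
    case False
    moreover have "a div b \<le> q" if "a < Suc q * b" for q
      using less_mult_imp_div_less[OF that] by simp
    ultimately show ?thesis
      using dividend_less_div_times[of b a] by (intro Least_equality) (auto simp flip: mult_Suc)
  qed simp
  ultimately show ?thesis by simp
qed

lemma recf_mod [recf_intros]:
  assumes f: "recf A f" and g: "recf A g"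
  shows "recf A (\<lambda>x. f x mod g x)"
  unfolding modulo_nat_def by (intro recf_intros f g)

section \<open>Finite sets as binary numbers\<close>

lemma dec_bit [recf_intros]:
  assumes "recf A f" "recf A g"
  shows "dec A (\<lambda>x. f x \<in> set_decode (g x))"
proof -
  have "dec A (\<lambda>x. (g x div 2 ^ f x) mod 2 = 1)" by (intro recf_intros assms)
  then show ?thesis by (simp add: set_decode_def odd_iff_mod_2_eq_one)
qed

lemma set_encode_restrict: "set_encode (A \<inter> {..<n}) = (\<Sum>i<n. of_bool (i \<in> A) * 2 ^ i)"
proof -
  have "(\<Sum>i<n. of_bool (i \<in> A) * 2 ^ i) = (\<Sum>i<n. if i \<in> A then 2 ^ i else 0 :: nat)"
    by (intro sum.cong) auto
  also have "\<dots> = (\<Sum>i\<in>{..<n} \<inter> A. 2 ^ i)"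
    by (simp add: sum.inter_restrict)
  finally show ?thesis by (simp add: set_encode_def Int_commute)
qed

lemma recf_restrict:
  assumes "dec B (\<lambda>x. x \<in> A)" and "recf B f"
  shows "recf B (\<lambda>x. set_encode (A \<inter> {..<f x}))"
  unfolding set_encode_restrict by (intro recf_intros dec_comp[OF assms(1)] assms(2))

section \<open>The join as least upper bound\<close>

lemma turing_le_join1: "A \<le>\<^sub>T A \<oplus>\<^sub>T B"
proof -
  have "dec (A \<oplus>\<^sub>T B) (\<lambda>x. 2 * x \<in> A \<oplus>\<^sub>T B)" by (intro dec_oracle recf_intros)
  moreover have "2 * x \<in> A \<oplus>\<^sub>T B \<longleftrightarrow> x \<in> A" for x
    unfolding turing_join_def by (auto, presburger)
  ultimately show ?thesis by (simp add: turing_le_iff_dec)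
qed

lemma turing_le_join2: "B \<le>\<^sub>T A \<oplus>\<^sub>T B"
proof -
  have "dec (A \<oplus>\<^sub>T B) (\<lambda>x. 2 * x + 1 \<in> A \<oplus>\<^sub>T B)" by (intro dec_oracle recf_intros)
  moreover have "2 * x + 1 \<in> A \<oplus>\<^sub>T B \<longleftrightarrow> x \<in> B" for x
    unfolding turing_join_def by (auto, presburger)
  ultimately show ?thesis by (simp add: turing_le_iff_dec)
qed

lemma turing_join_le:
  assumes "A \<le>\<^sub>T C" "B \<le>\<^sub>T C"
  shows "A \<oplus>\<^sub>T B \<le>\<^sub>T C"
proof -
  have "dec C (\<lambda>x. (x mod 2 = 0 \<and> x div 2 \<in> A) \<or> (x mod 2 = 1 \<and> x div 2 \<in> B))"
    using assms unfolding turing_le_iff_dec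
    by (intro recf_intros dec_comp[where F = "\<lambda>x. x \<in> A" and f = "\<lambda>x. x div 2"]
        dec_comp[where F = "\<lambda>x. x \<in> B" and f = "\<lambda>x. x div 2"])
  moreover have "(x mod 2 = 0 \<and> x div 2 \<in> A) \<or> (x mod 2 = 1 \<and> x div 2 \<in> B) \<longleftrightarrow> x \<in> A \<oplus>\<^sub>T B" for x
    unfolding turing_join_def
    by (cases "even x") (auto elim!: evenE oddE, presburger+)
  ultimately show ?thesis by (simp add: turing_le_iff_dec)
qed

section \<open>The halting problem\<close>

text \<open>The jump runs a program on its own index, so \<open>x\<close> is hard-wired: the search
  is composed with a program constantly \<open>x\<close>, whose index is primitive recursive in
  \<open>x\<close>.\<close>

lemma jump_empty_decides_ex:
  assumes "dec {} (\<lambda>z. Q (pfst z) (psnd z))"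
  shows "dec (jump {}) (\<lambda>x. \<exists>t. Q x t)"
proof -
  from dec_search_program[OF assms]
  obtain p where p: "\<And>x n. computes {} p x n \<longleftrightarrow> Q x n \<and> (\<forall>m<n. \<not> Q x m)" by blast
  define c where "c n = ((PComp PSucc) ^^ n) PZero" for n
  have c: "computes {} (c n) x y \<longleftrightarrow> y = n" for n x y
  proof -
    have "computes {} (c n) x n"
      by (induction n) (auto simp: c_def intro: computes.intros)
    then show ?thesis using computes_deterministic by blast
  qed
  have idx: "prog_index (c n) = rec_nat (prog_index PZero) (\<lambda>_ r. \<langle>6, \<langle>prog_index PSucc, r\<rangle>\<rangle>) n" for n
    by (induction n) (auto simp: c_def)
  have *: "prog_index (PComp p (c x)) \<in> jump {} \<longleftrightarrow> (\<exists>t. Q x t)" for x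
  proof -
    have "prog_index (PComp p (c x)) \<in> jump {} \<longleftrightarrow> (\<exists>y. computes {} p x y)"
      using inj_eq[OF inj_prog_index] computes_PComp_iff c unfolding jump_def mem_Collect_eq by metis
    also have "\<dots> \<longleftrightarrow> (\<exists>t. Q x t)"
      unfolding p by (metis exists_least_iff)
    finally show ?thesis .
  qed
  have "dec (jump {}) (\<lambda>x. \<langle>6, \<langle>prog_index p, rec_nat (prog_index PZero)
      (\<lambda>_ r. \<langle>6, \<langle>prog_index PSucc, r\<rangle>\<rangle>) x\<rangle>\<rangle> \<in> jump {})"
    by (intro dec_oracle recf_intros)
  with * show ?thesis by (simp add: idx)
qed

lemma jump_empty_decides_all:
  assumes "dec {} (\<lambda>z. Q (pfst z) (psnd z))"
  shows "dec (jump {}) (\<lambda>x. \<forall>t. Q x t)"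
  using dec_not[OF jump_empty_decides_ex[OF dec_not[OF assms]]] by simp

section \<open>Coded lists and coded derivations\<close>

lemma list_decode_Suc': "list_decode (Suc n) = pfst n # list_decode (psnd n)"
  by (simp split: prod.split)

lemma list_decode_eq_Nil_iff: "list_decode l = [] \<longleftrightarrow> l = 0"
  by (metis list_decode_inverse list_encode.simps(1) list_decode.simps(1))

lemma prod_decode_0: "prod_decode 0 = (0, 0)"
  using prod_encode_inverse[of "(0, 0)"] by (simp add: prod_encode_def)

text \<open>This also covers the empty list: \<open>prod_decode 0\<close> is \<open>(0, 0)\<close>,
  so code \<open>0\<close> is fixed and dropping past the end is harmless.\<close>

lemma list_decode_tl: "list_decode (psnd (l - 1)) = tl (list_decode l)"
  by (cases l) (simp_all add: prod_decode_0 list_decode_Suc' del: list_decode.simps(2))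

lemma list_decode_hd: "l \<noteq> 0 \<Longrightarrow> pfst (l - 1) = hd (list_decode l)"
  by (cases l) (simp_all add: list_decode_Suc' del: list_decode.simps(2))

definition ldrop :: "nat \<Rightarrow> nat \<Rightarrow> nat" where
  "ldrop i l = rec_nat l (\<lambda>_ r. psnd (r - 1)) i"

lemma list_decode_ldrop: "list_decode (ldrop i l) = drop i (list_decode l)"
  by (induction i) (simp_all add: ldrop_def list_decode_tl[simplified] drop_Suc tl_drop)

lemma recf_ldrop [recf_intros]: "recf A f \<Longrightarrow> recf A g \<Longrightarrow> recf A (\<lambda>x. ldrop (f x) (g x))"
  unfolding ldrop_def by (intro recf_intros recf_pred)

text \<open>Together with the bound on the length, this turns quantification over a coded list into
  bounded quantification.\<close>

lemma list_decode_less: "z \<in> set (list_decode l) \<Longrightarrow> z < l"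
proof (induction l rule: less_induct)
  case (less l)
  show ?case
  proof (cases l)
    case (Suc n)
    have "pfst n \<le> n" "psnd n \<le> n"
      by (metis le_prod_encode_1 le_prod_encode_2 prod.collapse prod_decode_inverse)+
    moreover from less.prems Suc have "z = pfst n \<or> z \<in> set (list_decode (psnd n))"
      by (simp add: list_decode_Suc' del: list_decode.simps(2))
    ultimately show ?thesis using less.IH[of "psnd n"] Suc by auto
  qed (use less in simp)
qed

lemma length_list_decode: "length (list_decode l) \<le> l"
proof (induction l rule: less_induct)
  case (less l)
  show ?case
  proof (cases l)
    case (Suc n)
    have "psnd n \<le> n"
      by (metis le_prod_encode_2 prod.collapse prod_decode_inverse)
    with less[of "psnd n"] Suc show ?thesis
      by (simp add: list_decode_Suc' del: list_decode.simps(2))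
  qed simp
qed

lemma dec_list_mem [recf_intros]:
  assumes "recf A f" "recf A g"
  shows "dec A (\<lambda>x. f x \<in> set (list_decode (g x)))"
proof -
  have "z \<in> set (list_decode l) \<longleftrightarrow> (\<exists>i<l. ldrop i l \<noteq> 0 \<and> pfst (ldrop i l - 1) = z)" for z l
  proof
    assume "z \<in> set (list_decode l)"
    then obtain i where i: "i < length (list_decode l)" "list_decode l ! i = z"
      by (auto simp: in_set_conv_nth)
    moreover have "ldrop i l \<noteq> 0"
      using i(1) by (simp flip: list_decode_eq_Nil_iff add: list_decode_ldrop)
    moreover have "pfst (ldrop i l - 1) = z"
      using i list_decode_hd[OF \<open>ldrop i l \<noteq> 0\<close>] by (simp add: list_decode_ldrop hd_drop_conv_nth)
    ultimately show "\<exists>i<l. ldrop i l \<noteq> 0 \<and> pfst (ldrop i l - 1) = z"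
      using length_list_decode[of l] by (intro exI[of _ i]) auto
  next
    assume "\<exists>i<l. ldrop i l \<noteq> 0 \<and> pfst (ldrop i l - 1) = z"
    then obtain i where i: "ldrop i l \<noteq> 0" "pfst (ldrop i l - 1) = z" by blast
    then have "drop i (list_decode l) \<noteq> []" "hd (drop i (list_decode l)) = z"
      using list_decode_eq_Nil_iff[of "ldrop i l"] list_decode_hd[of "ldrop i l"]
      by (simp_all add: list_decode_ldrop)
    then show "z \<in> set (list_decode l)"
      by (metis hd_in_set in_set_dropD)
  qed
  moreover have "dec A (\<lambda>x. \<exists>i<g x. ldrop i (g x) \<noteq> 0 \<and> pfst (ldrop i (g x) - 1) = f x)"
    by (intro recf_intros recf_comp[OF assms(1)] recf_comp[OF assms(2)] assms)
  ultimately show ?thesis by simp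
qed

lemma dec_ball_list [recf_intros]:
  assumes "dec A (\<lambda>z. P (pfst z) (psnd z))" "recf A g"
  shows "dec A (\<lambda>x. \<forall>z\<in>set (list_decode (g x)). P x z)"
proof -
  have "dec A (\<lambda>x. \<forall>z<g x. z \<in> set (list_decode (g x)) \<longrightarrow> P x z)"
    by (intro recf_intros recf_comp[OF assms(2)] assms)
  moreover have "(\<forall>z\<in>set (list_decode l). P x z) \<longleftrightarrow> (\<forall>z<l. z \<in> set (list_decode l) \<longrightarrow> P x z)" for l x
    using list_decode_less by blast
  ultimately show ?thesis by simp
qed

text \<open>
  A fact \<open>fct e x y\<close> states that the program with index \<open>e\<close> maps \<open>x\<close> to \<open>y\<close>.  Since
  \<^const>\<open>computes\<close> may succeed without evaluating a subprogram, well-formedness of indices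
  needs a certificate of its own, \<^term>\<open>fct \<langle>9, e\<rangle> 0 0\<close>: the tag 9 is not used by
  \<^const>\<open>prog_index\<close>.
\<close>

abbreviation fct :: "nat \<Rightarrow> nat \<Rightarrow> nat \<Rightarrow> nat" where "fct e x y \<equiv> \<langle>e, \<langle>x, y\<rangle>\<rangle>"

definition justified :: "nat set \<Rightarrow> nat \<Rightarrow> nat \<Rightarrow> nat \<Rightarrow> nat set \<Rightarrow> bool" where
  "justified A e x y S \<longleftrightarrow>
    e = \<langle>0, 0\<rangle> \<and> y = 0 \<or> e = \<langle>1, 0\<rangle> \<and> y = Suc x \<or> e = \<langle>2, 0\<rangle> \<and> y = pfst x \<or>
    e = \<langle>3, 0\<rangle> \<and> y = psnd x \<or> e = \<langle>4, 0\<rangle> \<and> y = of_bool (x \<in> A) \<or>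
    (\<exists>f g. e = \<langle>5, \<langle>f, g\<rangle>\<rangle> \<and> fct f x (pfst y) \<in> S \<and> fct g x (psnd y) \<in> S) \<or>
    (\<exists>f g. e = \<langle>6, \<langle>f, g\<rangle>\<rangle> \<and> (\<exists>u. fct g x u \<in> S \<and> fct f u y \<in> S)) \<or>
    (\<exists>f g. e = \<langle>7, \<langle>f, g\<rangle>\<rangle> \<and> psnd x = 0 \<and> fct f (pfst x) y \<in> S) \<or>
    (\<exists>f g. e = \<langle>7, \<langle>f, g\<rangle>\<rangle> \<and> psnd x \<noteq> 0 \<and> (\<exists>r. fct e \<langle>pfst x, psnd x - 1\<rangle> r \<in> S \<and>
        fct g \<langle>pfst x, \<langle>psnd x - 1, r\<rangle>\<rangle> y \<in> S)) \<or>
    (\<exists>f. e = \<langle>8, f\<rangle> \<and> fct f \<langle>x, y\<rangle> 0 \<in> S \<and> (\<forall>m<y. \<exists>u. fct f \<langle>x, m\<rangle> (Suc u) \<in> S)) \<or>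
    (\<exists>f. e = \<langle>9, f\<rangle> \<and>
      ((\<exists>k<5. f = \<langle>k, 0\<rangle>) \<or>
       (\<exists>k g h. k \<in> {5, 6, 7} \<and> f = \<langle>k, \<langle>g, h\<rangle>\<rangle> \<and> fct \<langle>9, g\<rangle> 0 0 \<in> S \<and> fct \<langle>9, h\<rangle> 0 0 \<in> S) \<or>
       (\<exists>g. f = \<langle>8, g\<rangle> \<and> fct \<langle>9, g\<rangle> 0 0 \<in> S)))"

lemma justified_mono: "justified A e x y S \<Longrightarrow> S \<subseteq> T \<Longrightarrow> justified A e x y T"
proof -
  assume "justified A e x y S" and ST: "S \<subseteq> T"
  then show ?thesis
    unfolding justified_def
    by (elim disj_forward ex_forward conj_forward all_forward imp_forward)
      (assumption | erule subsetD[OF ST])+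
qed

definition justified_fact :: "nat set \<Rightarrow> nat \<Rightarrow> nat set \<Rightarrow> bool" where
  "justified_fact A t S = justified A (pfst t) (pfst (psnd t)) (psnd (psnd t)) S"

text \<open>Derivations grow at the head and a fact cites only entries behind it. Hence, by
  monotonicity of \<open>justified\<close>, derivations can be concatenated.\<close>

primrec valid :: "nat set \<Rightarrow> nat list \<Rightarrow> bool" where
  "valid A [] \<longleftrightarrow> True"
| "valid A (t # ts) \<longleftrightarrow> justified_fact A t (set ts) \<and> valid A ts"

lemma justified_sound:
  assumes S: "\<And>p x y. fct (prog_index p) x y \<in> S \<Longrightarrow> computes A p x y"
    and "justified A (prog_index p) x y S"
  shows "computes A p x y"
proof (cases p)
  case (PPair f g)
  with assms(2) have "computes A f x (pfst y)" "computes A g x (psnd y)"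
    by (auto simp: justified_def intro: S)
  from computes.pair[OF this] PPair show ?thesis by simp
next
  case (PComp f g)
  with assms(2) show ?thesis
    by (auto simp: justified_def intro: S computes.comp)
next
  case (PRec f g)
  define a n where "a = pfst x" and "n = psnd x"
  then have x: "x = \<langle>a, n\<rangle>" by simp
  from assms(2) PRec have
    "n = 0 \<and> fct (prog_index f) a y \<in> S \<or>
     n \<noteq> 0 \<and> (\<exists>r. fct (prog_index p) \<langle>a, n - 1\<rangle> r \<in> S \<and> fct (prog_index g) \<langle>a, \<langle>n - 1, r\<rangle>\<rangle> y \<in> S)"
    unfolding a_def n_def by (auto simp: justified_def)
  then show ?thesis
  proof (elim disjE conjE exE)
    assume "n = 0" "fct (prog_index f) a y \<in> S"
    then show ?thesis unfolding x PRec by (auto intro: S computes.rec_0)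
  next
    fix r assume "n \<noteq> 0" and r: "fct (prog_index p) \<langle>a, n - 1\<rangle> r \<in> S"
      "fct (prog_index g) \<langle>a, \<langle>n - 1, r\<rangle>\<rangle> y \<in> S"
    then obtain k where "n = Suc k" by (cases n) auto
    with S[OF r(1)] S[OF r(2)] show ?thesis unfolding x PRec by (auto intro: computes.rec_Suc)
  qed
next
  case (PMin f)
  with assms(2) show ?thesis
    by (auto simp: justified_def intro: S intro!: computes.min)
next
  case PQuery
  with assms(2) have "y = of_bool (x \<in> A)" by (auto simp: justified_def)
  then show ?thesis unfolding PQuery by (simp only: computes.query)
qed (use assms(2) in \<open>auto simp: justified_def intro: computes.intros computes_pfst computes_psnd\<close>)

lemma valid_sound: "valid A ts \<Longrightarrow> fct (prog_index p) x y \<in> set ts \<Longrightarrow> computes A p x y"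
proof (induction ts arbitrary: p x y)
  case (Cons t ts)
  then show ?case
    by (auto simp: justified_fact_def intro: justified_sound[where S = "set ts"])
qed simp

lemma justified_prog_sound:
  assumes S: "\<And>e. fct \<langle>9, e\<rangle> 0 0 \<in> S \<Longrightarrow> e \<in> range prog_index"
    and "justified A \<langle>9, e\<rangle> x y S"
  shows "e \<in> range prog_index"
proof -
  have "\<langle>k, 0\<rangle> \<in> range prog_index" if "k < 5" for k
  proof -
    from that have "k = 0 \<or> k = 1 \<or> k = 2 \<or> k = 3 \<or> k = 4" by linarith
    then show ?thesis by (metis prog_index.simps(1-5) rangeI)
  qed
  moreover have "\<langle>k, \<langle>g, h\<rangle>\<rangle> \<in> range prog_index"
    if "k \<in> {5, 6, 7}" "g \<in> range prog_index" "h \<in> range prog_index" for k g h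
    using that by (auto simp flip: prog_index.simps)
  moreover have "\<langle>8, g\<rangle> \<in> range prog_index" if "g \<in> range prog_index" for g
    using that by (metis imageE prog_index.simps(9) rangeI)
  ultimately show ?thesis
    using assms(2) S by (auto simp: justified_def)
qed

lemma valid_prog_sound: "valid A ts \<Longrightarrow> fct \<langle>9, e\<rangle> 0 0 \<in> set ts \<Longrightarrow> e \<in> range prog_index"
proof (induction ts arbitrary: e)
  case (Cons t ts)
  then show ?case
    by (auto simp: justified_fact_def intro: justified_prog_sound[where S = "set ts"])
qed simp

definition derivable :: "nat set \<Rightarrow> nat \<Rightarrow> bool" where
  "derivable A t \<longleftrightarrow> (\<exists>ts. valid A ts \<and> t \<in> set ts)"

lemma valid_append: "valid A xs \<Longrightarrow> valid A ys \<Longrightarrow> valid A (xs @ ys)"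
  by (induction xs) (auto simp: justified_fact_def intro: justified_mono)

text \<open>Derivations of several facts merge into one; minimisation needs this for an unbounded,
  though finite, number of premises.\<close>

lemma derivable_finite:
  "finite T \<Longrightarrow> (\<And>t. t \<in> T \<Longrightarrow> derivable A t) \<Longrightarrow> \<exists>ts. valid A ts \<and> T \<subseteq> set ts"
proof (induction rule: finite_induct)
  case empty
  show ?case by (intro exI[of _ "[]"]) simp
next
  case (insert t T)
  then obtain xs ys where "valid A xs" "T \<subseteq> set xs" "valid A ys" "t \<in> set ys"
    unfolding derivable_def by (metis insertCI)
  then show ?case by (intro exI[of _ "xs @ ys"]) (auto simp: valid_append)
qed

lemma derivableI:
  assumes "finite T" "\<And>t. t \<in> T \<Longrightarrow> derivable A t" "justified A e x y T"
  shows "derivable A (fct e x y)"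
proof -
  from derivable_finite[OF assms(1,2)] obtain ts where "valid A ts" "T \<subseteq> set ts" by auto
  with assms(3) have "valid A (fct e x y # ts)"
    by (auto simp: justified_fact_def intro: justified_mono)
  then show ?thesis unfolding derivable_def by (metis list.set_intros(1))
qed

lemma derivable_computes: "computes A p x y \<Longrightarrow> derivable A (fct (prog_index p) x y)"
proof (induction rule: computes.induct)
  case (pair f x y g z)
  show ?case
    by (rule derivableI[of "{fct (prog_index f) x y, fct (prog_index g) x z}"])
      (use pair.IH in \<open>auto simp: justified_def\<close>)
next
  case (comp g x y f z)
  show ?case
    by (rule derivableI[of "{fct (prog_index g) x y, fct (prog_index f) y z}"])
      (use comp.IH in \<open>auto simp: justified_def\<close>)
next
  case (rec_0 f a y g)
  show ?case
    by (rule derivableI[of "{fct (prog_index f) a y}"])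
      (use rec_0.IH in \<open>auto simp: justified_def\<close>)
next
  case (rec_Suc f g a n r y)
  show ?case
    by (rule derivableI[of "{fct (prog_index (PRec f g)) \<langle>a, n\<rangle> r, fct (prog_index g) \<langle>a, \<langle>n, r\<rangle>\<rangle> y}"])
      (use rec_Suc.IH in \<open>auto simp: justified_def\<close>)
next
  case (min f a n)
  then obtain u where u: "\<And>m. m < n \<Longrightarrow> derivable A (fct (prog_index f) \<langle>a, m\<rangle> (Suc (u m)))"
    by metis
  show ?case
    by (rule derivableI[of "insert (fct (prog_index f) \<langle>a, n\<rangle> 0)
          ((\<lambda>m. fct (prog_index f) \<langle>a, m\<rangle> (Suc (u m))) ` {..<n})"])
      (use min.IH u in \<open>auto simp: justified_def\<close>)
qed (rule derivableI[of "{}"]; simp add: justified_def)+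

lemma derivable_prog: "derivable A (fct \<langle>9, prog_index p\<rangle> 0 0)"
proof (induction p)
  case (PPair f g)
  then show ?case
    by (intro derivableI[of "{fct \<langle>9, prog_index f\<rangle> 0 0, fct \<langle>9, prog_index g\<rangle> 0 0}"])
      (auto simp: justified_def)
next
  case (PComp f g)
  then show ?case
    by (intro derivableI[of "{fct \<langle>9, prog_index f\<rangle> 0 0, fct \<langle>9, prog_index g\<rangle> 0 0}"])
      (auto simp: justified_def)
next
  case (PRec f g)
  then show ?case
    by (intro derivableI[of "{fct \<langle>9, prog_index f\<rangle> 0 0, fct \<langle>9, prog_index g\<rangle> 0 0}"])
      (auto simp: justified_def)
next
  case (PMin f)
  then show ?case
    by (intro derivableI[of "{fct \<langle>9, prog_index f\<rangle> 0 0}"]) (auto simp: justified_def)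
qed (rule derivableI[of "{}"]; simp add: justified_def)+

text \<open>The stage \<open>L\<close> bounds the code of a derivation and thereby the input, the
  output and the oracle use at once. One parameter can thus serve as running time and as level of a
  tree.\<close>

definition hlt :: "nat set \<Rightarrow> nat \<Rightarrow> nat \<Rightarrow> nat \<Rightarrow> nat \<Rightarrow> bool" where
  "hlt A L e x y \<longleftrightarrow> (\<exists>l<L. valid A (list_decode l) \<and> fct e x y \<in> set (list_decode l) \<and>
    fct \<langle>9, e\<rangle> 0 0 \<in> set (list_decode l))"

lemma hlt_sound:
  assumes "hlt A L e x y"
  obtains p where "e = prog_index p" "computes A p x y"
  using assms valid_sound valid_prog_sound unfolding hlt_def by (metis imageE)

lemma hlt_computes: "hlt A L (prog_index p) x y \<Longrightarrow> computes A p x y"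
  by (metis hlt_sound injD inj_prog_index)

lemma hlt_complete: "computes A p x y \<Longrightarrow> \<exists>L. hlt A L (prog_index p) x y"
proof -
  assume "computes A p x y"
  then have "\<exists>ts. valid A ts \<and> {fct (prog_index p) x y, fct \<langle>9, prog_index p\<rangle> 0 0} \<subseteq> set ts"
    by (intro derivable_finite) (auto intro: derivable_computes derivable_prog)
  then show ?thesis unfolding hlt_def by (metis insert_subset lessI list_encode_inverse)
qed

lemma hlt_functional: "hlt A L e x y \<Longrightarrow> hlt A L' e x z \<Longrightarrow> y = z"
  by (metis hlt_sound computes_deterministic injD inj_prog_index)

lemma hlt_mono: "hlt A L e x y \<Longrightarrow> L \<le> L' \<Longrightarrow> hlt A L' e x y"
  unfolding hlt_def by (meson less_le_trans)

lemma fct_less: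
  assumes "fct e x y \<in> set (list_decode l)"
  shows "x < l" "y < l"
  using list_decode_less[OF assms] by (meson le_less_trans le_prod_encode_1 le_prod_encode_2 le_trans)+

lemma hlt_less: "hlt A L e x y \<Longrightarrow> x < L \<and> y < L"
  unfolding hlt_def using fct_less by (meson less_trans)

lemma valid_cong:
  assumes "\<And>t. t \<in> set ts \<Longrightarrow> pfst (psnd t) \<in> A \<longleftrightarrow> pfst (psnd t) \<in> B"
  shows "valid A ts \<longleftrightarrow> valid B ts"
  using assms by (induction ts) (auto simp: justified_fact_def justified_def)

text \<open>The use principle: every queried position occurs inside a fact of the derivation and is
  therefore smaller than its code.\<close>

lemma hlt_cong:
  assumes "A \<inter> {..<L} = B \<inter> {..<L}"
  shows "hlt A L e x y \<longleftrightarrow> hlt B L e x y"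
proof -
  have "valid A (list_decode l) \<longleftrightarrow> valid B (list_decode l)" if "l < L" for l
  proof (rule valid_cong)
    fix t assume "t \<in> set (list_decode l)"
    then have "pfst (psnd t) < l"
      using fct_less(1)[of "pfst t" "pfst (psnd t)" "psnd (psnd t)"] by simp
    with that have "pfst (psnd t) \<in> {..<L}" by simp
    with assms show "pfst (psnd t) \<in> A \<longleftrightarrow> pfst (psnd t) \<in> B" by blast
  qed
  then show ?thesis unfolding hlt_def by blast
qed

text \<open>Projections replace the quantifiers over subprograms, and membership in the list bounds
  the remaining witnesses by \<open>l\<close>; this makes the rules decidable.\<close>

lemma justified_list_decode:
  "justified A e x y (set (list_decode l)) \<longleftrightarrow>
    (let k = pfst e; f = pfst (psnd e); g = psnd (psnd e); S = set (list_decode l) in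
    e = \<langle>0, 0\<rangle> \<and> y = 0 \<or> e = \<langle>1, 0\<rangle> \<and> y = Suc x \<or> e = \<langle>2, 0\<rangle> \<and> y = pfst x \<or>
    e = \<langle>3, 0\<rangle> \<and> y = psnd x \<or> e = \<langle>4, 0\<rangle> \<and> y = of_bool (x \<in> A) \<or>
    k = 5 \<and> fct f x (pfst y) \<in> S \<and> fct g x (psnd y) \<in> S \<or>
    k = 6 \<and> (\<exists>u<l. fct g x u \<in> S \<and> fct f u y \<in> S) \<or>
    k = 7 \<and> psnd x = 0 \<and> fct f (pfst x) y \<in> S \<or>
    k = 7 \<and> psnd x \<noteq> 0 \<and> (\<exists>r<l. fct e \<langle>pfst x, psnd x - 1\<rangle> r \<in> S \<and>
        fct g \<langle>pfst x, \<langle>psnd x - 1, r\<rangle>\<rangle> y \<in> S) \<or>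
    k = 8 \<and> fct (psnd e) \<langle>x, y\<rangle> 0 \<in> S \<and> (\<forall>m<y. \<exists>u<l. fct (psnd e) \<langle>x, m\<rangle> (Suc u) \<in> S) \<or>
    k = 9 \<and>
      (let k = pfst (psnd e); g = pfst (psnd (psnd e)); h = psnd (psnd (psnd e)) in
       k < 5 \<and> psnd (psnd e) = 0 \<or>
       (k = 5 \<or> k = 6 \<or> k = 7) \<and> fct \<langle>9, g\<rangle> 0 0 \<in> S \<and> fct \<langle>9, h\<rangle> 0 0 \<in> S \<or>
       k = 8 \<and> fct \<langle>9, psnd (psnd e)\<rangle> 0 0 \<in> S))"
proof -
  have p: "(\<exists>f. e = \<langle>k, f\<rangle> \<and> Q f) \<longleftrightarrow> pfst e = k \<and> Q (psnd e)" for e k Q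
    by (metis fst_conv prod.collapse prod_decode_inverse prod_encode_inverse snd_conv)
  have pp: "(\<exists>f g. e = \<langle>k, \<langle>f, g\<rangle>\<rangle> \<and> Q f g) \<longleftrightarrow> pfst e = k \<and> Q (pfst (psnd e)) (psnd (psnd e))" for e k Q
    by (metis fst_conv prod.collapse prod_decode_inverse prod_encode_inverse snd_conv)
  have k5: "(\<exists>k<5. e = \<langle>k, 0\<rangle>) \<longleftrightarrow> pfst e < 5 \<and> psnd e = 0" for e
    by (metis fst_conv prod.collapse prod_decode_inverse prod_encode_inverse snd_conv)
  have k567: "(\<exists>k g h. k \<in> {5, 6, 7} \<and> e = \<langle>k, \<langle>g, h\<rangle>\<rangle> \<and> Q g h) \<longleftrightarrow>
      (pfst e = 5 \<or> pfst e = 6 \<or> pfst e = 7) \<and> Q (pfst (psnd e)) (psnd (psnd e))" for e Q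
    using pp[of e] by auto
  have u: "(\<exists>u. fct g x u \<in> set (list_decode l) \<and> Q u) \<longleftrightarrow>
      (\<exists>u<l. fct g x u \<in> set (list_decode l) \<and> Q u)" for g x Q
    using fct_less(2) by blast
  have u': "(\<exists>u. fct g x (Suc u) \<in> set (list_decode l)) \<longleftrightarrow>
      (\<exists>u<l. fct g x (Suc u) \<in> set (list_decode l))" for g x
    using fct_less(2) Suc_lessD by blast
  show ?thesis unfolding justified_def p pp k5 k567 u u' Let_def ..
qed

text \<open>The simulated oracle is a finite set given by the number \<open>w z\<close>, so the
  simulation itself consults no oracle.\<close>

lemma dec_justified [recf_intros]:
  assumes "recf A w" "recf A e" "recf A x" "recf A y" "recf A l"
  shows "dec A (\<lambda>z. justified (set_decode (w z)) (e z) (x z) (y z) (set (list_decode (l z))))"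
  unfolding justified_list_decode Let_def
  by (intro recf_intros recf_comp[OF assms(1)] recf_comp[OF assms(2)] recf_comp[OF assms(3)]
      recf_comp[OF assms(4)] recf_comp[OF assms(5)] assms)

lemma valid_nth: "valid A ts \<longleftrightarrow> (\<forall>i<length ts. justified_fact A (ts ! i) (set (drop (Suc i) ts)))"
  by (induction ts) (auto simp: All_less_Suc2)

lemma dec_valid [recf_intros]:
  assumes "recf A w" "recf A l"
  shows "dec A (\<lambda>z. valid (set_decode (w z)) (list_decode (l z)))"
proof -
  have "valid X (list_decode l) \<longleftrightarrow> (\<forall>i<l. ldrop i l \<noteq> 0 \<longrightarrow>
      justified_fact X (pfst (ldrop i l - 1)) (set (list_decode (psnd (ldrop i l - 1)))))" for X l
  proof -
    have eq: "ldrop i l \<noteq> 0 \<longleftrightarrow> i < length (list_decode l)" for i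
      by (metis drop_eq_Nil leD list_decode_eq_Nil_iff list_decode_ldrop not_le)
    have "pfst (ldrop i l - 1) = list_decode l ! i"
      "list_decode (psnd (ldrop i l - 1)) = drop (Suc i) (list_decode l)"
      if "i < length (list_decode l)" for i
      using that eq[of i] list_decode_hd[of "ldrop i l"] list_decode_tl[of "ldrop i l"]
      by (simp_all add: list_decode_ldrop hd_drop_conv_nth drop_Suc tl_drop)
    then show ?thesis
      unfolding valid_nth using length_list_decode[of l] eq by (metis less_le_trans)
  qed
  moreover have "dec A (\<lambda>z. \<forall>i<l z. ldrop i (l z) \<noteq> 0 \<longrightarrow>
      justified_fact (set_decode (w z)) (pfst (ldrop i (l z) - 1))
        (set (list_decode (psnd (ldrop i (l z) - 1)))))"
    unfolding justified_fact_def
    by (intro recf_intros recf_pred recf_comp[OF assms(1)] recf_comp[OF assms(2)] assms)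
  ultimately show ?thesis by simp
qed

lemma dec_hlt [recf_intros]:
  assumes "recf A w" "recf A L" "recf A e" "recf A x" "recf A y"
  shows "dec A (\<lambda>z. hlt (set_decode (w z)) (L z) (e z) (x z) (y z))"
  unfolding hlt_def
  by (intro recf_intros recf_comp[OF assms(1)] recf_comp[OF assms(2)] recf_comp[OF assms(3)]
      recf_comp[OF assms(4)] recf_comp[OF assms(5)] assms)

section \<open>Uniform probability on the subsets of an initial segment\<close>

text \<open>The measure of a clopen set, counted at level \<open>L\<close>. For an event with
  \<open>local_at j\<close> all levels from \<open>j\<close> on give the same value
  (\<open>prob_local\<close>).\<close>

definition prob :: "nat \<Rightarrow> (nat set \<Rightarrow> bool) \<Rightarrow> real" where
  "prob L P = real (card {X. X \<subseteq> {..<L} \<and> P X}) / 2 ^ L"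

definition local_at :: "nat \<Rightarrow> (nat set \<Rightarrow> bool) \<Rightarrow> bool" where
  "local_at L P \<longleftrightarrow> (\<forall>X Y. X \<inter> {..<L} = Y \<inter> {..<L} \<longrightarrow> P X = P Y)"

lemma local_atD: "local_at L P \<Longrightarrow> X \<inter> {..<L} = Y \<inter> {..<L} \<Longrightarrow> P X \<longleftrightarrow> P Y"
  unfolding local_at_def by blast

lemma Int_lessThan_mono:
  fixes X Y :: "nat set"
  shows "X \<inter> {..<L'} = Y \<inter> {..<L'} \<Longrightarrow> L \<le> L' \<Longrightarrow> X \<inter> {..<L} = Y \<inter> {..<L}"
proof -
  assume XY: "X \<inter> {..<L'} = Y \<inter> {..<L'}" and "L \<le> L'"
  from \<open>L \<le> L'\<close> have *: "Z \<inter> {..<L} = Z \<inter> {..<L'} \<inter> {..<L}" for Z :: "nat set"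
    by auto
  show "X \<inter> {..<L} = Y \<inter> {..<L}" unfolding *[of X] *[of Y] XY ..
qed

lemma local_at_mono: "local_at L P \<Longrightarrow> L \<le> L' \<Longrightarrow> local_at L' P"
  unfolding local_at_def using Int_lessThan_mono by metis

lemma finite_level: "finite {X. X \<subseteq> {..<L::nat} \<and> P X}"
  by (rule finite_subset[of _ "Pow {..<L}"]) auto

lemma prob_mono: "(\<And>X. X \<subseteq> {..<L} \<Longrightarrow> P X \<Longrightarrow> Q X) \<Longrightarrow> prob L P \<le> prob L Q"
  unfolding prob_def
  by (intro divide_right_mono) (auto intro!: card_mono finite_level)

lemma prob_cong: "(\<And>X. X \<subseteq> {..<L} \<Longrightarrow> P X \<longleftrightarrow> Q X) \<Longrightarrow> prob L P = prob L Q"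
  by (intro antisym prob_mono) auto

lemma prob_True: "prob L (\<lambda>_. True) = 1"
  by (simp add: prob_def card_Pow flip: Pow_def)

lemma prob_False: "prob L (\<lambda>_. False) = 0"
  by (simp add: prob_def)

lemma prob_le_1: "prob L P \<le> 1"
  using prob_mono[of L P "\<lambda>_. True"] by (simp add: prob_True)

lemma prob_disj_disjoint:
  assumes "\<And>X. X \<subseteq> {..<L} \<Longrightarrow> \<not> (P X \<and> Q X)"
  shows "prob L (\<lambda>X. P X \<or> Q X) = prob L P + prob L Q"
proof -
  have "{X. X \<subseteq> {..<L} \<and> (P X \<or> Q X)} = {X. X \<subseteq> {..<L} \<and> P X} \<union> {X. X \<subseteq> {..<L} \<and> Q X}"
    by auto
  moreover have "card \<dots> = card {X. X \<subseteq> {..<L} \<and> P X} + card {X. X \<subseteq> {..<L} \<and> Q X}"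
    using assms by (intro card_Un_disjoint finite_level) auto
  ultimately show ?thesis by (simp add: prob_def add_divide_distrib)
qed

lemma prob_split: "prob L P = prob L (\<lambda>X. P X \<and> Q X) + prob L (\<lambda>X. P X \<and> \<not> Q X)"
  by (subst prob_disj_disjoint[symmetric]) (auto intro: prob_cong)

lemma prob_disj_le: "prob L (\<lambda>X. P X \<or> Q X) \<le> prob L P + prob L Q"
proof -
  have "prob L (\<lambda>X. P X \<or> Q X) = prob L P + prob L (\<lambda>X. Q X \<and> \<not> P X)"
    by (subst prob_disj_disjoint[symmetric]) (auto intro: prob_cong)
  also have "prob L (\<lambda>X. Q X \<and> \<not> P X) \<le> prob L Q"
    by (rule prob_mono) auto
  finally show ?thesis by simp
qed

lemma prob_diff_ge: "prob L P - prob L Q \<le> prob L (\<lambda>X. P X \<and> \<not> Q X)"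
proof -
  have "prob L (\<lambda>X. P X \<and> Q X) \<le> prob L Q" by (rule prob_mono) auto
  then show ?thesis using prob_split[of L P Q] by simp
qed

lemma prob_bex_le: "finite I \<Longrightarrow> prob L (\<lambda>X. \<exists>i\<in>I. P i X) \<le> (\<Sum>i\<in>I. prob L (P i))"
proof (induction rule: finite_induct)
  case (insert i I)
  then show ?case
    using prob_disj_le[of L "P i" "\<lambda>X. \<exists>i\<in>I. P i X"] by simp
qed (simp add: prob_False)

lemma prob_bex_disjoint:
  assumes "finite I" "\<And>X i j. i \<in> I \<Longrightarrow> j \<in> I \<Longrightarrow> P i X \<Longrightarrow> P j X \<Longrightarrow> i = j"
  shows "prob L (\<lambda>X. \<exists>i\<in>I. P i X) = (\<Sum>i\<in>I. prob L (P i))"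
  using assms
proof (induction rule: finite_induct)
  case (insert i I)
  have "prob L (\<lambda>X. P i X \<or> (\<exists>i\<in>I. P i X)) = prob L (P i) + prob L (\<lambda>X. \<exists>i\<in>I. P i X)"
    using insert.hyps(2) insert.prems by (intro prob_disj_disjoint) blast
  with insert show ?case by simp
qed (simp add: prob_False)

text \<open>Independence of disjoint sets of coordinates, in counting form.\<close>

lemma card_subsets_product:
  assumes "finite B" "finite C" "B \<inter> C = {}"
  shows "card {X. X \<subseteq> B \<union> C \<and> P (X \<inter> B) \<and> Q (X \<inter> C)} =
    card {Y. Y \<subseteq> B \<and> P Y} * card {Z. Z \<subseteq> C \<and> Q Z}"
proof -
  have "bij_betw (\<lambda>X. (X \<inter> B, X \<inter> C)) {X. X \<subseteq> B \<union> C \<and> P (X \<inter> B) \<and> Q (X \<inter> C)}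
      ({Y. Y \<subseteq> B \<and> P Y} \<times> {Z. Z \<subseteq> C \<and> Q Z})"
  proof (rule bij_betw_byWitness[where f' = "\<lambda>(Y, Z). Y \<union> Z"])
    have *: "(Y \<union> Z) \<inter> B = Y" "(Y \<union> Z) \<inter> C = Z" if "Y \<subseteq> B" "Z \<subseteq> C" for Y Z
      using that assms(3) by auto
    then show "\<forall>a'\<in>{Y. Y \<subseteq> B \<and> P Y} \<times> {Z. Z \<subseteq> C \<and> Q Z}.
        (\<lambda>X. (X \<inter> B, X \<inter> C)) ((\<lambda>(Y, Z). Y \<union> Z) a') = a'" by auto
    show "(\<lambda>(Y, Z). Y \<union> Z) ` ({Y. Y \<subseteq> B \<and> P Y} \<times> {Z. Z \<subseteq> C \<and> Q Z})
        \<subseteq> {X. X \<subseteq> B \<union> C \<and> P (X \<inter> B) \<and> Q (X \<inter> C)}"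
      using * by auto
  qed auto
  then show ?thesis
    by (simp add: bij_betw_same_card card_cartesian_product)
qed

lemma prob_local:
  assumes "local_at j P" "j \<le> L"
  shows "prob L P = prob j P"
proof -
  have "{X. X \<subseteq> {..<L} \<and> P X} = {X. X \<subseteq> {..<j} \<union> {j..<L} \<and> P (X \<inter> {..<j}) \<and> True}"
  proof -
    have "P X \<longleftrightarrow> P (X \<inter> {..<j})" for X
      by (rule local_atD[OF assms(1)]) auto
    moreover have "{..<L} = {..<j} \<union> {j..<L}" using assms(2) by auto
    ultimately show ?thesis by simp
  qed
  also have "card \<dots> = card {Y. Y \<subseteq> {..<j} \<and> P Y} * card {Z. Z \<subseteq> {j..<L} \<and> True}"
    by (rule card_subsets_product) auto
  also have "card {Z. Z \<subseteq> {j..<L} \<and> True} = 2 ^ (L - j)"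
    by (simp add: card_Pow flip: Pow_def)
  finally have "card {X. X \<subseteq> {..<L} \<and> P X} = card {Y. Y \<subseteq> {..<j} \<and> P Y} * 2 ^ (L - j)" .
  moreover have "(2::real) ^ L = 2 ^ j * 2 ^ (L - j)"
    using assms(2) by (simp flip: power_add)
  ultimately show ?thesis by (simp add: prob_def)
qed

lemma prob_trace:
  assumes "B \<subseteq> {..<L}" "U \<subseteq> B"
  shows "prob L (\<lambda>X. X \<inter> B = U) = 1 / 2 ^ card B"
proof -
  have "finite B" using assms finite_subset by blast
  have "{X. X \<subseteq> {..<L} \<and> X \<inter> B = U} = {X. X \<subseteq> B \<union> ({..<L} - B) \<and> X \<inter> B = U \<and> True}"
    using assms by auto
  also have "card \<dots> = card {Y. Y \<subseteq> B \<and> Y = U} * card {Z. Z \<subseteq> {..<L} - B \<and> True}"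
    using \<open>finite B\<close> by (intro card_subsets_product) auto
  also have "{Y. Y \<subseteq> B \<and> Y = U} = {U}" using assms by auto
  also have "card {Z. Z \<subseteq> {..<L} - B \<and> True} = 2 ^ (L - card B)"
    using assms \<open>finite B\<close> by (simp add: card_Pow card_Diff_subset flip: Pow_def)
  finally have "card {X. X \<subseteq> {..<L} \<and> X \<inter> B = U} = 2 ^ (L - card B)"
    by simp
  then show ?thesis
  proof -
    have "card B \<le> L" using card_mono[OF _ assms(1)] by simp
    then have "(2::real) ^ L = 2 ^ card B * 2 ^ (L - card B)" by (simp flip: power_add)
    with \<open>card {X. X \<subseteq> {..<L} \<and> X \<inter> B = U} = _\<close> show ?thesis by (simp add: prob_def)
  qed
qed

text \<open>One block is split off at a time and the others are counted in the complement, which is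
  why \<open>W\<close> varies in the induction.\<close>

lemma card_meeting_blocks:
  fixes B :: "'i \<Rightarrow> 'a set"
  assumes "finite G" "finite W" "\<And>i. i \<in> G \<Longrightarrow> B i \<subseteq> W"
    and "\<And>i j. i \<in> G \<Longrightarrow> j \<in> G \<Longrightarrow> i \<noteq> j \<Longrightarrow> B i \<inter> B j = {}"
  shows "real (card {X. X \<subseteq> W \<and> (\<forall>i\<in>G. X \<inter> B i \<noteq> {})}) =
    2 ^ card W * (\<Prod>i\<in>G. 1 - 1 / 2 ^ card (B i))"
  using assms
proof (induction arbitrary: W rule: finite_induct)
  case empty
  then show ?case by (simp add: card_Pow flip: Pow_def)
next
  case (insert i G)
  have fin: "finite (B i)" and le: "card (B i) \<le> card W"
    using insert.prems(1,2) by (auto intro: finite_subset card_mono)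
  have *: "X \<inter> B j = (X \<inter> (W - B i)) \<inter> B j" if "j \<in> G" for X j
    using insert.prems(2)[of j] insert.prems(3)[of i j] insert.hyps(2) that by auto
  have "{X. X \<subseteq> W \<and> (\<forall>j\<in>insert i G. X \<inter> B j \<noteq> {})} =
      {X. X \<subseteq> B i \<union> (W - B i) \<and> X \<inter> B i \<noteq> {} \<and> (\<forall>j\<in>G. (X \<inter> (W - B i)) \<inter> B j \<noteq> {})}"
  proof -
    have "B i \<union> (W - B i) = W" using insert.prems(2)[of i] by auto
    moreover have "(\<forall>j\<in>insert i G. X \<inter> B j \<noteq> {}) \<longleftrightarrow>
        X \<inter> B i \<noteq> {} \<and> (\<forall>j\<in>G. (X \<inter> (W - B i)) \<inter> B j \<noteq> {})" for X
      using *[of _ X] by (metis insert_iff)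
    ultimately show ?thesis by simp
  qed
  moreover have "card \<dots> = card {Y. Y \<subseteq> B i \<and> Y \<noteq> {}} *
      card {Z. Z \<subseteq> W - B i \<and> (\<forall>j\<in>G. Z \<inter> B j \<noteq> {})}"
    using fin insert.prems(1) by (intro card_subsets_product) auto
  moreover have "card {Y. Y \<subseteq> B i \<and> Y \<noteq> {}} = 2 ^ card (B i) - 1"
  proof -
    have "{Y. Y \<subseteq> B i \<and> Y \<noteq> {}} = Pow (B i) - {{}}" by auto
    then show ?thesis using fin by (simp add: card_Pow)
  qed
  ultimately have "real (card {X. X \<subseteq> W \<and> (\<forall>j\<in>insert i G. X \<inter> B j \<noteq> {})}) =
      (2 ^ card (B i) - 1) * real (card {Z. Z \<subseteq> W - B i \<and> (\<forall>j\<in>G. Z \<inter> B j \<noteq> {})})"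
    by (simp add: of_nat_diff)
  moreover have "real (card {Z. Z \<subseteq> W - B i \<and> (\<forall>j\<in>G. Z \<inter> B j \<noteq> {})}) =
      2 ^ card (W - B i) * (\<Prod>j\<in>G. 1 - 1 / 2 ^ card (B j))"
    using insert.prems insert.hyps(2) by (intro insert.IH) (blast+)
  moreover have "(2::real) ^ card (W - B i) = 2 ^ card W / 2 ^ card (B i)"
    using fin le insert.prems(2)[of i] by (simp add: card_Diff_subset power_diff)
  ultimately show ?case
    using insert.hyps by (simp add: field_simps)
qed

text \<open>A quantitative converse Borel-Cantelli lemma: \<open>1 - x \<le> exp (- x)\<close> turns
  the product of the independent probabilities into the exponential of minus the weight, while
  \<open>1 / 2 ^ g\<close> is at least \<open>exp (- g)\<close>.\<close>

lemma weight_of_missed_blocks: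
  assumes "finite G" "\<And>i. i \<in> G \<Longrightarrow> B i \<subseteq> {..<L}"
    and "\<And>i j. i \<in> G \<Longrightarrow> j \<in> G \<Longrightarrow> i \<noteq> j \<Longrightarrow> B i \<inter> B j = {}"
    and "1 / 2 ^ g \<le> prob L (\<lambda>X. \<forall>i\<in>G. X \<inter> B i \<noteq> {})"
  shows "(\<Sum>i\<in>G. 1 / 2 ^ card (B i)) \<le> real g"
proof -
  have "exp (- real g) \<le> 1 / 2 ^ g"
  proof -
    have "(2::real) \<le> exp 1" using exp_ge_add_one_self[of 1] by simp
    then have "(2::real) ^ g \<le> exp (real g)"
      using power_mono[of 2 "exp (1::real)" g] by (simp flip: exp_of_nat_mult)
    then show ?thesis by (simp add: exp_minus field_simps)
  qed
  also have "1 / 2 ^ g \<le> (\<Prod>i\<in>G. 1 - 1 / 2 ^ card (B i) :: real)"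
    using assms(4) card_meeting_blocks[OF assms(1) _ assms(2,3)] by (simp add: prob_def)
  also have "\<dots> \<le> (\<Prod>i\<in>G. exp (- (1 / 2 ^ card (B i))))"
  proof (intro prod_mono conjI)
    show "1 - 1 / 2 ^ card (B i) \<le> exp (- (1 / 2 ^ card (B i)) :: real)" for i
      using exp_ge_add_one_self[of "- (1 / 2 ^ card (B i)) :: real"] by simp
  qed simp
  also have "\<dots> = exp (- (\<Sum>i\<in>G. 1 / 2 ^ card (B i)))"
    using assms(1) by (simp add: exp_sum flip: sum_negf)
  finally show ?thesis by simp
qed

section \<open>Trees of positive measure\<close>

text \<open>Represents the closed class of all \<open>X\<close> with \<open>T L X\<close> for every
  \<open>L\<close>; a decidable \<open>T\<close> gives an effectively closed class. Levels need not
  be pruned: \<open>T L X\<close> does not promise an extension at the next level.\<close>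

definition tree :: "(nat \<Rightarrow> nat set \<Rightarrow> bool) \<Rightarrow> bool" where
  "tree T \<longleftrightarrow> (\<forall>L. local_at L (T L)) \<and> (\<forall>L L' X. L \<le> L' \<longrightarrow> T L' X \<longrightarrow> T L X)"

lemma tree_local: "tree T \<Longrightarrow> local_at L (T L)"
  by (simp add: tree_def)

lemma tree_antimono: "tree T \<Longrightarrow> T L' X \<Longrightarrow> L \<le> L' \<Longrightarrow> T L X"
  by (auto simp: tree_def)

lemma local_at_trace: "j \<le> L \<Longrightarrow> local_at L (\<lambda>X. X \<inter> {..<j} = U)"
  unfolding local_at_def using Int_lessThan_mono by metis

lemma local_at_conj: "local_at L P \<Longrightarrow> local_at L Q \<Longrightarrow> local_at L (\<lambda>X. P X \<and> Q X)"
  unfolding local_at_def by metis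

lemma tree_prob_antimono:
  assumes "tree T" "local_at L Q" "L \<le> L'"
  shows "prob L' (\<lambda>X. Q X \<and> T L' X) \<le> prob L (\<lambda>X. Q X \<and> T L X)"
proof -
  have "prob L' (\<lambda>X. Q X \<and> T L' X) \<le> prob L' (\<lambda>X. Q X \<and> T L X)"
    using tree_antimono[OF assms(1) _ assms(3)] by (intro prob_mono) auto
  also have "\<dots> = prob L (\<lambda>X. Q X \<and> T L X)"
    by (rule prob_local[OF local_at_conj[OF assms(2) tree_local[OF assms(1)]] assms(3)])
  finally show ?thesis .
qed

text \<open>Every initial segment of \<open>X\<close> must retain at least the fraction
  \<open>1 / 2 ^ g\<close> of the measure of its cylinder. Density is tested at level
  \<open>L\<close> itself, which keeps the test decidable and antitone in \<open>L\<close>.\<close>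

definition dense_core :: "nat \<Rightarrow> (nat \<Rightarrow> nat set \<Rightarrow> bool) \<Rightarrow> nat \<Rightarrow> nat set \<Rightarrow> bool" where
  "dense_core g T L X \<longleftrightarrow> T L X \<and>
    (\<forall>j\<le>L. 1 / 2 ^ (g + j) \<le> prob L (\<lambda>Y. Y \<inter> {..<j} = X \<inter> {..<j} \<and> T L Y))"

lemma tree_dense_core:
  assumes "tree T"
  shows "tree (dense_core g T)"
  unfolding tree_def
proof (intro conjI allI impI)
  show "local_at L (dense_core g T L)" for L
    unfolding local_at_def
  proof (intro allI impI)
    fix X Y :: "nat set" assume XY: "X \<inter> {..<L} = Y \<inter> {..<L}"
    have "X \<inter> {..<j} = Y \<inter> {..<j}" if "j \<le> L" for j
      using Int_lessThan_mono[OF XY that] .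
    then show "dense_core g T L X = dense_core g T L Y"
      using local_atD[OF tree_local[OF assms] XY] by (simp add: dense_core_def)
  qed
next
  fix L L' :: nat and X assume LL: "L \<le> L'" and "dense_core g T L' X"
  then have T: "T L' X"
    and *: "\<And>j. j \<le> L' \<Longrightarrow> 1 / 2 ^ (g + j) \<le> prob L' (\<lambda>Y. Y \<inter> {..<j} = X \<inter> {..<j} \<and> T L' Y)"
    by (auto simp: dense_core_def)
  have "1 / 2 ^ (g + j) \<le> prob L (\<lambda>Y. Y \<inter> {..<j} = X \<inter> {..<j} \<and> T L Y)" if "j \<le> L" for j
    using *[of j] that LL tree_prob_antimono[OF assms local_at_trace[OF that] LL, of "X \<inter> {..<j}"]
    by linarith
  with tree_antimono[OF assms T LL] show "dense_core g T L X"
    by (simp add: dense_core_def)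
qed

text \<open>Sort by the shortest sparse initial segment: a sparse cylinder contributes less than
  \<open>\<delta>\<close> times its measure, and these cylinders are disjoint. The downward
  induction on \<open>j\<close> splits a cylinder that is not sparse into its two halves.\<close>

lemma prob_sparse_part:
  fixes \<delta> :: real and P :: "nat set \<Rightarrow> bool" and sparse :: "nat \<Rightarrow> nat set \<Rightarrow> bool"
  assumes "j \<le> L" "0 \<le> \<delta>"
  defines "sparse \<equiv> (\<lambda>i X. prob L (\<lambda>Y. Y \<inter> {..<i} = X \<inter> {..<i} \<and> P Y) < \<delta> / 2 ^ i)"
  shows "prob L (\<lambda>X. X \<inter> {..<j} = U \<and> P X \<and> (\<exists>i\<in>{j..L}. sparse i X)) \<le> \<delta> / 2 ^ j"
  using assms(1)
proof (induction arbitrary: U rule: inc_induct)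
  case base
  show ?case
  proof (cases "prob L (\<lambda>Y. Y \<inter> {..<L} = U \<and> P Y) < \<delta> / 2 ^ L")
    case True
    have "prob L (\<lambda>X. X \<inter> {..<L} = U \<and> P X \<and> (\<exists>i\<in>{L..L}. sparse i X)) \<le> prob L (\<lambda>X. X \<inter> {..<L} = U \<and> P X)"
      by (intro prob_mono) auto
    with True show ?thesis by linarith
  next
    case False
    then have "prob L (\<lambda>X. X \<inter> {..<L} = U \<and> P X \<and> (\<exists>i\<in>{L..L}. sparse i X)) = prob L (\<lambda>_. False)"
      by (intro prob_cong) (auto simp: sparse_def)
    with assms(2) show ?thesis by (simp add: prob_False)
  qed
next
  case (step j)
  show ?case
  proof (cases "prob L (\<lambda>Y. Y \<inter> {..<j} = U \<and> P Y) < \<delta> / 2 ^ j")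
    case True
    have "prob L (\<lambda>X. X \<inter> {..<j} = U \<and> P X \<and> (\<exists>i\<in>{j..L}. sparse i X)) \<le> prob L (\<lambda>X. X \<inter> {..<j} = U \<and> P X)"
      by (intro prob_mono) auto
    with True show ?thesis by linarith
  next
    case False
    define E where "E V X \<longleftrightarrow> X \<inter> {..<Suc j} = V \<and> P X \<and> (\<exists>i\<in>{Suc j..L}. sparse i X)" for V X
    have "prob L (\<lambda>X. X \<inter> {..<j} = U \<and> P X \<and> (\<exists>i\<in>{j..L}. sparse i X)) \<le> prob L (\<lambda>X. E U X \<or> E (insert j U) X)"
    proof (rule prob_mono)
      fix X assume X: "X \<inter> {..<j} = U \<and> P X \<and> (\<exists>i\<in>{j..L}. sparse i X)"
      then obtain i where i: "i \<in> {j..L}" "sparse i X" by blast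
      with X False have "i \<noteq> j" by (auto simp: sparse_def)
      with i have "i \<in> {Suc j..L}" by auto
      moreover have "X \<inter> {..<Suc j} = U \<or> X \<inter> {..<Suc j} = insert j U"
        using X by (cases "j \<in> X") (auto simp: lessThan_Suc)
      ultimately show "E U X \<or> E (insert j U) X" using X i(2) unfolding E_def by blast
    qed
    also have "\<dots> \<le> prob L (E U) + prob L (E (insert j U))" by (rule prob_disj_le)
    also have "\<dots> \<le> \<delta> / 2 ^ Suc j + \<delta> / 2 ^ Suc j"
      unfolding E_def by (intro add_mono step.IH)
    finally show ?thesis by simp
  qed
qed

text \<open>With density threshold \<open>1 / 2 ^ Suc q\<close> the sparse part takes at most half
  of the guaranteed measure.\<close>

lemma prob_dense_core:
  assumes "1 / 2 ^ q \<le> prob L (T L)"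
  shows "1 / 2 ^ Suc q \<le> prob L (dense_core (Suc q) T L)"
proof -
  define bad where "bad X \<longleftrightarrow> (\<exists>i\<in>{0..L}. prob L (\<lambda>Y. Y \<inter> {..<i} = X \<inter> {..<i} \<and> T L Y) <
    (1 / 2 ^ Suc q) / 2 ^ i)" for X
  have "prob L (\<lambda>X. T L X \<and> bad X) \<le> 1 / 2 ^ Suc q"
    using prob_sparse_part[where j = 0 and L = L and \<delta> = "1 / 2 ^ Suc q" and P = "T L" and U = "{}"]
    by (simp add: bad_def)
  moreover have "prob L (\<lambda>X. T L X \<and> \<not> bad X) \<le> prob L (dense_core (Suc q) T L)"
    by (intro prob_mono) (auto simp: bad_def dense_core_def not_less power_add mult.assoc)
  moreover have "1 / 2 ^ q = 2 * (1 / 2 ^ Suc q :: real)" by simp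
  ultimately show ?thesis
    using assms prob_split[of L "T L" bad] by linarith
qed

text \<open>Pigeonhole over the finitely many stems of length \<open>L\<^sub>0\<close>: if each died
  at some level, none would survive the largest of these levels.\<close>

lemma tree_compactness:
  assumes "tree T" "local_at L\<^sub>0 C" "\<And>L. L\<^sub>0 \<le> L \<Longrightarrow> \<exists>X. T L X \<and> C X"
  obtains U where "U \<subseteq> {..<L\<^sub>0}" "C U" "\<And>L. \<exists>X. X \<inter> {..<L\<^sub>0} = U \<and> T L X"
proof -
  have "\<exists>U\<in>{U. U \<subseteq> {..<L\<^sub>0} \<and> C U}. \<forall>L. \<exists>X. X \<inter> {..<L\<^sub>0} = U \<and> T L X"
  proof (rule ccontr)
    assume "\<not> ?thesis"
    then obtain l where l: "\<And>U X. U \<subseteq> {..<L\<^sub>0} \<Longrightarrow> C U \<Longrightarrow> X \<inter> {..<L\<^sub>0} = U \<Longrightarrow> \<not> T (l U) X"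
      by (metis (no_types, lifting) mem_Collect_eq)
    define M where "M = Max (insert L\<^sub>0 (l ` {U. U \<subseteq> {..<L\<^sub>0} \<and> C U}))"
    have M: "L\<^sub>0 \<le> M" "\<And>U. U \<subseteq> {..<L\<^sub>0} \<Longrightarrow> C U \<Longrightarrow> l U \<le> M"
      unfolding M_def using finite_level[of L\<^sub>0 C] by (auto intro!: Max_ge)
    from assms(3)[OF M(1)] obtain X where X: "T M X" "C X" by blast
    have "C (X \<inter> {..<L\<^sub>0})" using X(2) local_atD[OF assms(2), of X "X \<inter> {..<L\<^sub>0}"] by auto
    with l[of "X \<inter> {..<L\<^sub>0}" X] M(2)[of "X \<inter> {..<L\<^sub>0}"] tree_antimono[OF assms(1) X(1)]
    show False by auto
  qed
  with that show ?thesis by blast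
qed

section \<open>Effective counting of finite levels\<close>

lemma set_decode_subset_iff: "set_decode w \<subseteq> {..<L} \<longleftrightarrow> w < 2 ^ L"
proof
  assume "w < 2 ^ L"
  have "\<not> i \<in> set_decode w" if "L \<le> i" for i
  proof -
    have "w < 2 ^ i"
      using \<open>w < 2 ^ L\<close> power_increasing[OF that, of "2::nat"] by linarith
    then show ?thesis by (simp add: set_decode_def)
  qed
  then show "set_decode w \<subseteq> {..<L}" by (metis lessThan_iff not_le subsetI)
next
  assume "set_decode w \<subseteq> {..<L}"
  then have "set_encode (set_decode w) \<le> (\<Sum>i<L. 2 ^ i)"
    unfolding set_encode_def by (intro sum_mono2) auto
  also have "\<dots> < 2 ^ L" by (induction L) auto
  finally show "w < 2 ^ L" by simp
qed

lemma card_subsets_conv_sum: "card {X. X \<subseteq> {..<L} \<and> P X} = (\<Sum>w<2 ^ L. of_bool (P (set_decode w)))"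
proof -
  have "bij_betw set_decode {w. w < 2 ^ L \<and> P (set_decode w)} {X. X \<subseteq> {..<L} \<and> P X}"
    by (rule bij_betw_byWitness[where f' = set_encode])
      (auto simp: set_decode_subset_iff[symmetric] finite_subset[OF _ finite_lessThan])
  then have "card {X. X \<subseteq> {..<L} \<and> P X} = card {w. w < 2 ^ L \<and> P (set_decode w)}"
    by (simp add: bij_betw_same_card)
  also have "\<dots> = (\<Sum>w<2 ^ L. of_bool (P (set_decode w)))"
    by (simp add: sum.If_cases of_bool_def lessThan_def Int_def)
  finally show ?thesis .
qed

lemma dec_prob_ge [recf_intros]:
  assumes "dec A (\<lambda>z. P (pfst z) (set_decode (psnd z)))" "recf A L" "recf A q"
  shows "dec A (\<lambda>x. 1 / 2 ^ q x \<le> prob (L x) (P x))"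
proof -
  have "1 / 2 ^ k \<le> prob l Q \<longleftrightarrow> 2 ^ l \<le> (\<Sum>w<2 ^ l. of_bool (Q (set_decode w))) * (2 ^ k :: nat)" for k l Q
  proof -
    have "1 / 2 ^ k \<le> prob l Q \<longleftrightarrow> 2 ^ l \<le> real (card {X. X \<subseteq> {..<l} \<and> Q X}) * 2 ^ k"
      unfolding prob_def by (simp add: field_simps)
    also have "\<dots> \<longleftrightarrow> 2 ^ l \<le> card {X. X \<subseteq> {..<l} \<and> Q X} * 2 ^ k"
      by (metis (no_types, lifting) of_nat_le_iff of_nat_mult of_nat_numeral of_nat_power)
    finally show ?thesis by (simp add: card_subsets_conv_sum)
  qed
  moreover have "dec A (\<lambda>x. 2 ^ L x \<le> (\<Sum>w<2 ^ L x. of_bool (P x (set_decode w))) * (2 ^ q x :: nat))"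
    by (intro recf_intros assms)
  ultimately show ?thesis by simp
qed

section \<open>Bit strings and prefix-free machines\<close>

lemma inj_bitstring_code: "inj bitstring_code"
proof (rule injI)
  fix \<sigma> \<tau> assume "bitstring_code \<sigma> = bitstring_code \<tau>"
  then have "map of_bool \<sigma> = (map of_bool \<tau> :: nat list)"
    unfolding bitstring_code_def by (rule injD[OF inj_list_encode])
  then show "\<sigma> = \<tau>" by (rule map_injective) (simp add: inj_def)
qed

lemma length_initial_segment [simp]: "length (X \<restriction> n) = n"
  by (simp add: initial_segment_def)

lemma nth_initial_segment [simp]: "i < n \<Longrightarrow> (X \<restriction> n) ! i \<longleftrightarrow> i \<in> X"
  by (simp add: initial_segment_def)

lemma initial_segment_eq_iff: "X \<restriction> n = Y \<restriction> n \<longleftrightarrow> X \<inter> {..<n} = Y \<inter> {..<n}"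
  unfolding initial_segment_def map_eq_conv set_eq_iff Int_iff set_upt atLeast0LessThan by blast

lemma initial_segment_Suc: "X \<restriction> Suc n = X \<restriction> n @ [n \<in> X]"
  by (simp add: initial_segment_def)

lemma initial_segment_UNIV: "UNIV \<restriction> n = replicate n True"
  by (simp add: initial_segment_def map_replicate_const)

text \<open>Justifies representing a string by its length and a number, the pair
  \<open>(k, v)\<close> used from here on.\<close>

lemma bitstring_eq_initial_segment:
  obtains v where "v < 2 ^ length \<sigma>" "\<sigma> = set_decode v \<restriction> length \<sigma>"
proof
  let ?X = "{i. i < length \<sigma> \<and> \<sigma> ! i}"
  have "finite ?X" by simp
  then show "set_encode ?X < 2 ^ length \<sigma>"
    by (auto simp flip: set_decode_subset_iff)
  show "\<sigma> = set_decode (set_encode ?X) \<restriction> length \<sigma>"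
    using \<open>finite ?X\<close> by (auto intro!: nth_equalityI)
qed

lemma recf_bitstring_code [recf_intros]:
  assumes "recf A w" "recf A n"
  shows "recf A (\<lambda>x. bitstring_code (set_decode (w x) \<restriction> n x))"
proof -
  have "rec_nat 0 (\<lambda>k r. Suc \<langle>of_bool (n - Suc k \<in> X), r\<rangle>) m = bitstring_code (drop (n - m) (X \<restriction> n))"
    if "m \<le> n" for X n m
    using that
  proof (induction m)
    case 0
    show ?case by (simp add: bitstring_code_def)
  next
    case (Suc m)
    then have "drop (n - Suc m) (X \<restriction> n) = (n - Suc m \<in> X) # drop (n - m) (X \<restriction> n)"
      using Cons_nth_drop_Suc[of "n - Suc m" "X \<restriction> n"] by (simp add: Suc_diff_Suc)
    with Suc show ?case by (simp add: bitstring_code_def)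
  qed
  from this[of "n _" "n _"] have "bitstring_code (set_decode (w x) \<restriction> n x) =
      rec_nat 0 (\<lambda>k r. Suc \<langle>of_bool (n x - Suc k \<in> set_decode (w x)), r\<rangle>) (n x)" for x
    by simp
  moreover have "recf A (\<lambda>x. rec_nat 0 (\<lambda>k r. Suc \<langle>of_bool (n x - Suc k \<in> set_decode (w x)), r\<rangle>) (n x))"
    by (intro recf_intros recf_comp[OF assms(1)] recf_comp[OF assms(2)] assms)
  ultimately show ?thesis by simp
qed

lemma recf_bitstring_code_ones [recf_intros]:
  assumes "recf A n"
  shows "recf A (\<lambda>x. bitstring_code (UNIV \<restriction> n x))"
proof -
  have "bitstring_code (UNIV \<restriction> n) = rec_nat 0 (\<lambda>k r. Suc \<langle>1, r\<rangle>) n" for n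
    by (induction n) (simp_all add: bitstring_code_def initial_segment_UNIV)
  moreover have "recf A (\<lambda>x. rec_nat 0 (\<lambda>k r. Suc \<langle>1, r\<rangle>) (n x))"
    by (intro recf_intros assms)
  ultimately show ?thesis by simp
qed

text \<open>\<open>set_decode\<close> lists the least significant digit first; reversal makes
  prefixes correspond to leading digits, as dyadic intervals require.\<close>

lemma recf_bitstring_code_rev [recf_intros]:
  assumes "recf A w" "recf A n"
  shows "recf A (\<lambda>x. bitstring_code (rev (set_decode (w x) \<restriction> n x)))"
proof -
  have "bitstring_code (rev (X \<restriction> n)) = rec_nat 0 (\<lambda>k r. Suc \<langle>of_bool (k \<in> X), r\<rangle>) n" for X n
    by (induction n) (simp_all add: bitstring_code_def initial_segment_Suc, simp add: initial_segment_def)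
  moreover have "recf A (\<lambda>x. rec_nat 0 (\<lambda>k r. Suc \<langle>of_bool (k \<in> set_decode (w x)), r\<rangle>) (n x))"
    by (intro recf_intros recf_comp[OF assms(1)] recf_comp[OF assms(2)] assms)
  ultimately show ?thesis by simp
qed

text \<open>Being a prefix means containment of dyadic intervals: dropping the last
  \<open>m - n\<close> digits of \<open>b\<close> leaves \<open>a\<close>.\<close>

lemma prefix_rev_initial_segment:
  assumes "prefix (rev (set_decode a \<restriction> n)) (rev (set_decode b \<restriction> m))" "a < 2 ^ n" "b < 2 ^ m"
  shows "n \<le> m" "a = b div 2 ^ (m - n)"
proof -
  from assms(1) obtain zs where "rev (set_decode b \<restriction> m) = rev (set_decode a \<restriction> n) @ zs"
    by (auto simp: prefix_def)
  then have eq: "set_decode b \<restriction> m = rev zs @ set_decode a \<restriction> n"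
    by (metis rev_append rev_rev_ident)
  from arg_cong[OF this, of length] have len: "m = length zs + n" by simp
  then show "n \<le> m" by simp
  have "k \<in> set_decode a \<longleftrightarrow> k \<in> set_decode (b div 2 ^ (m - n))" for k
  proof -
    have "k \<in> set_decode (b div 2 ^ (m - n)) \<longleftrightarrow> k + (m - n) \<in> set_decode b"
      by (simp add: set_decode_def power_add div_mult2_eq[symmetric] mult.commute)
    moreover have "k + (m - n) \<in> set_decode b \<longleftrightarrow> k \<in> set_decode a"
    proof (cases "k < n")
      case True
      then have "(set_decode b \<restriction> m) ! (k + length zs) = (set_decode a \<restriction> n) ! k"
        unfolding eq by (simp add: nth_append)
      with True len show ?thesis by simp
    next
      case False
      with len show ?thesis
        using assms(2,3) by (auto simp flip: set_decode_subset_iff)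
    qed
    ultimately show ?thesis by simp
  qed
  then show "a = b div 2 ^ (m - n)"
    by (metis set_decode_inverse set_eqI)
qed

text \<open>
  The codeword of request \<^term>\<open>i\<close> is a dyadic interval of length \<open>1 / 2 ^ Suc (l i)\<close> inside the
  \<open>i\<close>-th of consecutive intervals of lengths \<open>1 / 2 ^ l i\<close>; the extra bit pays for the alignment.
\<close>

lemma Kraft_Chaitin:
  fixes l out :: "nat \<Rightarrow> nat" and \<tau> :: "nat \<Rightarrow> bitstring"
  assumes act: "dec {} act" and l: "recf {} l" and out: "recf {} out"
    and out_code: "\<And>i. act i \<Longrightarrow> out i = bitstring_code (\<tau> i)"
    and weight: "\<And>n. (\<Sum>i\<in>{i. i < n \<and> act i}. 1 / 2 ^ l i) \<le> (1::real)"
  shows "\<exists>M. prefix_free_machine M \<and> (\<forall>i. act i \<longrightarrow> K M (\<tau> i) \<le> enat (Suc (l i)))"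
proof -
  define q where "q n = (\<Sum>i\<in>{i. i < n \<and> act i}. 1 / 2 ^ l i :: real)" for n
  have q_mono: "q i \<le> q j" if "i \<le> j" for i j
    unfolding q_def using that by (intro sum_mono2) auto
  have q_Suc: "q (Suc i) = q i + 1 / 2 ^ l i" if "act i" for i
  proof -
    have "{j. j < Suc i \<and> act j} = insert i {j. j < i \<and> act j}"
      using that by (auto simp: less_Suc_eq)
    then show ?thesis by (simp add: q_def)
  qed
  \<comment> \<open>\<open>2 ^ B i\<close> is a common denominator for the weights up to request
    \<open>i\<close>, with a spare bit for the halved interval. Numerators keep the partial sums
    \<open>q i\<close> within the natural numbers and so computable.\<close>
  define B where "B i = Suc (\<Sum>j<Suc i. l j)" for i
  define num where "num i = (\<Sum>j<i. of_bool (act j) * 2 ^ (B i - l j) :: nat)" for i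
  define d where "d i = B i - Suc (l i)" for i
  \<comment> \<open>\<open>q i\<close> rounded up to a multiple of
    \<open>1 / 2 ^ Suc (l i)\<close>.\<close>
  define a where "a i = (num i + (2 ^ d i - 1)) div 2 ^ d i" for i
  have l_le_B: "l j < B i" if "j \<le> i" for i j
    unfolding B_def using that member_le_sum[of j "{..<Suc i}" l] by (simp del: sum.lessThan_Suc)
  have num: "real (num i) = q i * 2 ^ B i" for i
  proof -
    have "real (num i) = (\<Sum>j<i. if act j then 2 ^ (B i - l j) else 0)"
      unfolding num_def of_nat_sum by (intro sum.cong) auto
    also have "\<dots> = (\<Sum>j<i. if act j then 1 / 2 ^ l j * 2 ^ B i else 0)"
      using l_le_B by (intro sum.cong) (auto simp: power_diff less_imp_le)
    also have "\<dots> = q i * 2 ^ B i"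
      by (simp add: q_def sum_distrib_right sum.inter_filter[symmetric])
    finally show ?thesis .
  qed
  have B_split: "(2::real) ^ B i = 2 ^ d i * 2 ^ Suc (l i)" for i
    using l_le_B[of i i] by (simp add: d_def flip: power_add power_Suc)
  \<comment> \<open>Rounding costs less than one unit \<open>1 / 2 ^ Suc (l i)\<close> and the
    interval takes another; two units are exactly the reserved \<open>1 / 2 ^ l i\<close>.\<close>
  have a_ge: "q i \<le> a i / 2 ^ Suc (l i)" and a_less: "(a i + 1) / 2 ^ Suc (l i) < q i + 1 / 2 ^ l i" for i
  proof -
    have pos: "0 < (2::nat) ^ d i" by simp
    have "num i + (2 ^ d i - 1) < a i * 2 ^ d i + 2 ^ d i"
      unfolding a_def using dividend_less_div_times[OF pos, of "num i + (2 ^ d i - 1)"] by simp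
    then have "num i \<le> a i * 2 ^ d i" using pos by linarith
    then have "real (num i) \<le> real (a i * 2 ^ d i)" by (simp only: of_nat_le_iff)
    then have "real (num i) \<le> real (a i) * 2 ^ d i" by simp
    then show "q i \<le> a i / 2 ^ Suc (l i)"
      unfolding num B_split by (simp add: field_simps)
    have "a i * 2 ^ d i \<le> num i + (2 ^ d i - 1)"
      unfolding a_def by (rule div_times_less_eq_dividend)
    then have "a i * 2 ^ d i < num i + 2 ^ d i" using pos by linarith
    then have "real (a i * 2 ^ d i) < real (num i + 2 ^ d i)" by (simp only: of_nat_less_iff)
    then have "real (a i) * 2 ^ d i < real (num i) + 2 ^ d i" by simp
    then have "real (a i) * 2 ^ d i < (q i * 2 ^ Suc (l i) + 1) * 2 ^ d i"
      unfolding num B_split by (simp add: algebra_simps)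
    then have "real (a i) < q i * 2 ^ Suc (l i) + 1"
      by (simp only: mult_less_cancel_right_pos zero_less_power zero_less_numeral)
    then have "real (a i) + 1 < (q i + 1 / 2 ^ l i) * 2 ^ Suc (l i)"
      by (simp add: algebra_simps)
    then show "(a i + 1) / 2 ^ Suc (l i) < q i + 1 / 2 ^ l i"
      by (simp only: pos_divide_less_eq zero_less_power zero_less_numeral of_nat_add of_nat_1)
  qed
  define str where "str i = rev (set_decode (a i) \<restriction> Suc (l i))" for i
  have a_bound: "a i < 2 ^ Suc (l i)" if "act i" for i
  proof -
    have "(a i + 1) / 2 ^ Suc (l i) < 1"
      using a_less[of i] weight[of "Suc i"] q_Suc[OF that] unfolding q_def by linarith
    then have "real (a i) < real (2 ^ Suc (l i))" by simp
    then show ?thesis by (simp only: of_nat_less_iff)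
  qed
  have str_prefix: "i = j" if "act i" "act j" "prefix (str i) (str j)" for i j
  proof -
    note pr = prefix_rev_initial_segment[OF that(3)[unfolded str_def] a_bound[OF that(1)] a_bound[OF that(2)]]
    define e where "e = Suc (l j) - Suc (l i)"
    \<comment> \<open>The left end of the interval of \<open>j\<close>. The prefix relation puts it
      into the interval of \<open>i\<close> as well, but the reserved intervals of different
      requests are disjoint.\<close>
    define x where "x = a j / 2 ^ Suc (l j)"
    have l_eq: "Suc (l j) = Suc (l i) + e" using pr(1) by (simp add: e_def)
    have "a i * 2 ^ e \<le> a j"
      unfolding pr(2) e_def by (rule div_times_less_eq_dividend)
    then have "real (a i * 2 ^ e) \<le> real (a j)" by (simp only: of_nat_le_iff)
    then have "real (a i) * 2 ^ e \<le> real (a j)" by simp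
    then have "a i / 2 ^ Suc (l i) \<le> x"
      unfolding x_def l_eq power_add by (simp add: field_simps)
    have "a j < (a i + 1) * 2 ^ e"
      unfolding pr(2) e_def using dividend_less_div_times[of "2 ^ e" "a j"] by (simp add: e_def)
    then have "real (a j) < real ((a i + 1) * 2 ^ e)" by (simp only: of_nat_less_iff)
    then have "real (a j) < (real (a i) + 1) * 2 ^ e" by (simp add: algebra_simps)
    then have "x < (a i + 1) / 2 ^ Suc (l i)"
      unfolding x_def l_eq power_add by (simp add: field_simps)
    have xi: "q i \<le> x" "x < q (Suc i)"
      using \<open>a i / 2 ^ Suc (l i) \<le> x\<close> \<open>x < (a i + 1) / 2 ^ Suc (l i)\<close> a_ge[of i] a_less[of i] q_Suc[OF that(1)]
      by linarith+
    have "x < (a j + 1) / 2 ^ Suc (l j)"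
      unfolding x_def by (intro divide_strict_right_mono) auto
    then have xj: "q j \<le> x" "x < q (Suc j)"
      using a_ge[of j] a_less[of j] q_Suc[OF that(2)] unfolding x_def by linarith+
    show "i = j"
    proof (rule ccontr)
      assume "i \<noteq> j"
      then have "Suc i \<le> j \<or> Suc j \<le> i" by linarith
      with xi xj show False using q_mono by (meson le_less_trans less_irrefl less_le_trans)
    qed
  qed
  define M where "M \<sigma> = (if \<exists>i. act i \<and> str i = \<sigma> then Some (\<tau> (THE i. act i \<and> str i = \<sigma>)) else None)" for \<sigma>
  have M_str: "M (str i) = Some (\<tau> i)" if "act i" for i
  proof -
    have "(THE j. act j \<and> str j = str i) = i"
      using that str_prefix by (intro the_equality) auto
    with that show ?thesis by (auto simp: M_def)
  qed
  have M_dom: "\<exists>i. act i \<and> str i = \<sigma>" if "M \<sigma> \<noteq> None" for \<sigma>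
    using that unfolding M_def by (auto split: if_splits)
  have "dec {} (\<lambda>z. act (psnd z) \<and> bitstring_code (str (psnd z)) = pfst z)"
    unfolding str_def a_def num_def d_def B_def
    by (intro recf_intros dec_comp[OF act] recf_comp[OF l])
  from dec_search_program[where P = "\<lambda>x i. act i \<and> bitstring_code (str i) = x", OF this]
  obtain p where p: "\<And>x i. computes {} p x i \<longleftrightarrow>
      (act i \<and> bitstring_code (str i) = x) \<and> (\<forall>m<i. \<not> (act m \<and> bitstring_code (str m) = x))"
    by blast
  from out obtain po where po: "\<And>x. computes {} po x (out x)" unfolding recf_def by blast
  have po': "computes {} po x y \<longleftrightarrow> y = out x" for x y
    using po computes_deterministic by blast
  have code: "bitstring_code (str i) = bitstring_code \<sigma> \<longleftrightarrow> str i = \<sigma>" for i \<sigma>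
    using inj_bitstring_code by (simp add: inj_eq)
  have "computes {} (PComp po p) (bitstring_code \<sigma>) y \<longleftrightarrow> (\<exists>\<rho>. M \<sigma> = Some \<rho> \<and> y = bitstring_code \<rho>)" for \<sigma> y
  proof
    assume "computes {} (PComp po p) (bitstring_code \<sigma>) y"
    then obtain i where "act i" "str i = \<sigma>" "y = out i"
      by (auto simp: computes_PComp_iff p po' code)
    with M_str out_code show "\<exists>\<rho>. M \<sigma> = Some \<rho> \<and> y = bitstring_code \<rho>" by auto
  next
    assume "\<exists>\<rho>. M \<sigma> = Some \<rho> \<and> y = bitstring_code \<rho>"
    then obtain i where i: "act i" "str i = \<sigma>" "y = bitstring_code (\<tau> i)"
      using M_dom[of \<sigma>] M_str by force
    have "m = i" if "act m" "str m = \<sigma>" for m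
      using str_prefix[OF that(1) i(1)] that(2) i(2) by simp
    with i have "computes {} p (bitstring_code \<sigma>) i"
      unfolding p code by blast
    with i show "computes {} (PComp po p) (bitstring_code \<sigma>) y"
      by (auto simp: computes_PComp_iff po' out_code)
  qed
  then have "partial_computable M" unfolding partial_computable_def by blast
  moreover have "\<forall>\<sigma>\<in>dom M. \<forall>\<rho>\<in>dom M. prefix \<sigma> \<rho> \<longrightarrow> \<sigma> = \<rho>"
    using M_dom str_prefix unfolding dom_def by blast
  moreover have "K M (\<tau> i) \<le> enat (Suc (l i))" if "act i" for i
  proof -
    have "K M (\<tau> i) \<le> enat (length (str i))"
      unfolding K_def using M_str[OF that] by (intro INF_lower) simp
    then show ?thesis by (simp add: str_def)
  qed
  ultimately show ?thesis unfolding prefix_free_machine_def by blast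
qed

lemma K_attained:
  assumes "K M \<sigma> \<noteq> \<infinity>"
  obtains \<rho> where "M \<rho> = Some \<sigma>" "K M \<sigma> = enat (length \<rho>)"
proof -
  let ?S = "(\<lambda>\<rho>. enat (length \<rho>)) ` {\<rho>. M \<rho> = Some \<sigma>}"
  have "?S \<noteq> {}"
  proof
    assume "?S = {}"
    then have "K M \<sigma> = \<infinity>" unfolding K_def by (simp add: top_enat_def)
    with assms show False by blast
  qed
  then have "Inf ?S \<in> ?S"
    unfolding Inf_enat_def by (auto intro: LeastI)
  then show ?thesis using that unfolding K_def by auto
qed

lemma dec_hlt_empty [recf_intros]:
  assumes "recf A L" "recf A e" "recf A x" "recf A y"
  shows "dec A (\<lambda>z. hlt {} (L z) (e z) (x z) (y z))"
  using dec_hlt[OF recf_const[of A 0] assms] by simp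

section \<open>Requests for descriptions of initial segments\<close>

text \<open>
  The request \<^term>\<open>\<langle>\<langle>k, v\<rangle>, \<langle>n, a\<rangle>\<rangle>\<close> says: the string coded by \<open>(k, v)\<close> describes \<open>1\<^sup>n\<close>, hence a
  description of length about \<open>k\<close> is wanted for the string of length \<open>n\<close> coded by \<open>a\<close>.  A set meets
  the request with parameter \<open>m\<close> if it avoids the block of the request.  Blocks are pairwise
  disjoint, so meeting different requests are independent events of probability \<open>1 / 2 ^ (k + m)\<close>.
\<close>

definition block :: "nat \<Rightarrow> nat \<Rightarrow> nat set" where
  "block m r = (\<lambda>j. \<langle>r, j\<rangle>) ` {..<pfst (pfst r) + m}"

lemma finite_block: "finite (block m r)"
  by (simp add: block_def)

lemma card_block: "card (block m r) = pfst (pfst r) + m"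
  unfolding block_def by (subst card_image) (auto simp: inj_on_def)

lemma block_disjoint: "r \<noteq> s \<Longrightarrow> block m r \<inter> block m s = {}"
  by (auto simp: block_def)

lemma block_subset_iff: "block m r \<subseteq> {..<L} \<longleftrightarrow> (\<forall>j<pfst (pfst r) + m. \<langle>r, j\<rangle> < L)"
  by (auto simp: block_def)

lemma avoids_block_iff: "X \<inter> block m r = {} \<longleftrightarrow> (\<forall>j<pfst (pfst r) + m. \<langle>r, j\<rangle> \<notin> X)"
  by (auto simp: block_def)

definition req :: "nat set \<Rightarrow> nat \<Rightarrow> nat \<Rightarrow> nat \<Rightarrow> nat" where
  "req A k v n = \<langle>\<langle>k, v\<rangle>, \<langle>n, set_encode (A \<inter> {..<n})\<rangle>\<rangle>"

locale optimal_machine =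
  fixes U :: "bitstring \<Rightarrow> bitstring option" and pU :: prog
  assumes optimal: "optimal_prefix_free_machine U"
    and computes_pU: "computes {} pU (bitstring_code \<sigma>) y \<longleftrightarrow> (\<exists>\<tau>. U \<sigma> = Some \<tau> \<and> y = bitstring_code \<tau>)"
begin

definition describes :: "nat \<Rightarrow> nat \<Rightarrow> nat \<Rightarrow> nat \<Rightarrow> bool" where
  "describes L k v y \<longleftrightarrow> hlt {} L (prog_index pU) (bitstring_code (set_decode v \<restriction> k)) y"

lemma dec_describes [recf_intros]:
  assumes "recf A L" "recf A k" "recf A v" "recf A y"
  shows "dec A (\<lambda>z. describes (L z) (k z) (v z) (y z))"
  unfolding describes_def by (intro recf_intros assms)

lemma describes_mono: "describes L k v y \<Longrightarrow> L \<le> L' \<Longrightarrow> describes L' k v y"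
  unfolding describes_def by (rule hlt_mono)

lemma describes_sound: "describes L k v (bitstring_code \<tau>) \<Longrightarrow> U (set_decode v \<restriction> k) = Some \<tau>"
  using hlt_computes computes_pU inj_bitstring_code unfolding describes_def by (metis injD)

lemma describes_complete: "U (set_decode v \<restriction> k) = Some \<tau> \<Longrightarrow> \<exists>L. describes L k v (bitstring_code \<tau>)"
  using hlt_complete computes_pU unfolding describes_def by metis

text \<open>Prefix-freeness makes the cylinders of halting strings disjoint, so their probabilities
  add up to at most 1.\<close>

lemma Kraft_inequality:
  assumes "finite G" and G: "\<And>k v. (k, v) \<in> G \<Longrightarrow> v < 2 ^ k \<and> U (set_decode v \<restriction> k) \<noteq> None"
  shows "(\<Sum>(k, v)\<in>G. 1 / 2 ^ k) \<le> (1::real)"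
proof -
  define L where "L = Max (insert 0 (fst ` G))"
  have L: "k \<le> L" if "(k, v) \<in> G" for k v
    unfolding L_def using assms(1) that by (intro Max_ge) force+
  define E where "E kv X \<longleftrightarrow> X \<inter> {..<fst kv} = set_decode (snd kv)" for kv :: "nat \<times> nat" and X
  have prob_E: "prob L (E kv) = 1 / 2 ^ fst kv" if "kv \<in> G" for kv
    unfolding E_def
    using prob_trace[of "{..<fst kv}" L "set_decode (snd kv)"] that L[of "fst kv" "snd kv"] G[of "fst kv" "snd kv"]
    by (simp add: set_decode_subset_iff)
  have aux: "kv = kv'" if "kv \<in> G" "kv' \<in> G" "E kv X" "E kv' X" "fst kv \<le> fst kv'" for kv kv' X
  proof -
    obtain k v k' v' where kv: "kv = (k, v)" "kv' = (k', v')" by fastforce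
    have seg: "set_decode v \<restriction> k = X \<restriction> k" "set_decode v' \<restriction> k' = X \<restriction> k'"
      using that(3,4) kv by (auto simp: E_def initial_segment_eq_iff)
    have "X \<restriction> k = take k (X \<restriction> k')"
      using that(5) kv by (simp add: initial_segment_def take_map)
    then have "prefix (X \<restriction> k) (X \<restriction> k')" by (simp add: take_is_prefix)
    moreover have "U (X \<restriction> k) \<noteq> None" "U (X \<restriction> k') \<noteq> None"
      using G[of k v] G[of k' v'] that(1,2) kv seg by auto
    ultimately have "X \<restriction> k = X \<restriction> k'"
      using optimal unfolding optimal_prefix_free_machine_def prefix_free_machine_def by blast
    then have "k = k'" by (metis length_initial_segment)
    moreover have "set_decode v = set_decode v'"
      using that(3,4) kv \<open>k = k'\<close> by (simp add: E_def)
    then have "v = v'" by (metis set_decode_inverse)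
    ultimately show ?thesis using kv by simp
  qed
  have "(\<Sum>(k, v)\<in>G. 1 / 2 ^ k) = (\<Sum>kv\<in>G. prob L (E kv))"
    by (intro sum.cong) (auto simp: prob_E)
  also have "\<dots> = prob L (\<lambda>X. \<exists>kv\<in>G. E kv X)"
    by (rule prob_bex_disjoint[symmetric, OF assms(1)]) (metis aux nat_le_linear)
  also have "\<dots> \<le> 1" by (rule prob_le_1)
  finally show ?thesis .
qed

text \<open>Lengthening every request by \<open>c\<close> scales the weight below 1; this
  \<open>c\<close> and the optimality constant both go into \<open>d\<close>.\<close>

lemma K_le_weight:
  fixes l out :: "nat \<Rightarrow> nat" and \<tau> :: "nat \<Rightarrow> bitstring"
  assumes "dec {} act" "recf {} l" "recf {} out"
    and "\<And>i. act i \<Longrightarrow> out i = bitstring_code (\<tau> i)"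
    and weight: "\<And>n. (\<Sum>i\<in>{i. i < n \<and> act i}. 1 / 2 ^ l i) \<le> (2 ^ c :: real)"
  shows "\<exists>d. \<forall>i. act i \<longrightarrow> K U (\<tau> i) \<le> enat (l i + d)"
proof -
  have "(\<Sum>i\<in>{i. i < n \<and> act i}. 1 / 2 ^ (l i + c)) \<le> (1::real)" for n
  proof -
    have "(\<Sum>i\<in>{i. i < n \<and> act i}. 1 / 2 ^ (l i + c)) = (\<Sum>i\<in>{i. i < n \<and> act i}. 1 / 2 ^ l i) / (2 ^ c :: real)"
      by (simp add: sum_divide_distrib power_add)
    also have "\<dots> \<le> 1" using weight[of n] by simp
    finally show ?thesis .
  qed
  moreover have "recf {} (\<lambda>i. l i + c)" by (intro recf_intros assms)
  ultimately obtain M where M: "prefix_free_machine M" "\<And>i. act i \<Longrightarrow> K M (\<tau> i) \<le> enat (Suc (l i + c))"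
    using Kraft_Chaitin[of act "\<lambda>i. l i + c" out \<tau>] assms by blast
  from M(1) optimal obtain c' where c': "\<And>\<sigma>. K U \<sigma> \<le> K M \<sigma> + enat c'"
    unfolding optimal_prefix_free_machine_def by blast
  have "K U (\<tau> i) \<le> enat (l i + (Suc c + c'))" if "act i" for i
  proof -
    have "K U (\<tau> i) \<le> enat (Suc (l i + c)) + enat c'"
      using c'[of "\<tau> i"] M(2)[OF that] by (meson add_right_mono order_trans)
    then show ?thesis by (simp add: ac_simps)
  qed
  then show ?thesis by blast
qed

text \<open>
  The requests missed by the tree form a c.e. superset of the requests of \<^term>\<open>A\<close>; independence of
  the blocks bounds its weight.
\<close>

lemma K_trivial_if_requests_missed:
  assumes T: "tree T" and dec_T: "dec {} (\<lambda>z. T (pfst z) (set_decode (psnd z)))"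
    and meas: "\<And>L. 1 / 2 ^ g \<le> prob L (T L)"
    and missed: "\<And>k v n. v < 2 ^ k \<Longrightarrow> U (set_decode v \<restriction> k) = Some (UNIV \<restriction> n) \<Longrightarrow>
      \<exists>t. \<forall>X. T t X \<longrightarrow> X \<inter> block m (req A k v n) \<noteq> {}"
  shows "K_trivial U A"
proof -
  \<comment> \<open>Membership of the whole block below \<open>t\<close> lets independence be
    applied at a finite level when the weights are summed.\<close>
  define wit where "wit r t \<longleftrightarrow> psnd (pfst r) < 2 ^ pfst (pfst r) \<and>
    describes t (pfst (pfst r)) (psnd (pfst r)) (bitstring_code (UNIV \<restriction> pfst (psnd r))) \<and>
    (\<forall>j<pfst (pfst r) + m. \<langle>r, j\<rangle> < t) \<and>
    \<not> (\<exists>w<2 ^ t. T t (set_decode w) \<and> (\<forall>j<pfst (pfst r) + m. \<langle>r, j\<rangle> \<notin> set_decode w))" for r t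
  have dec_wit: "dec {} (\<lambda>z. wit (pfst z) (psnd z))"
    unfolding wit_def by (intro recf_intros dec_comp2[OF dec_T])
  have wit_missed: "X \<inter> block m r \<noteq> {}" if "wit r t" "T L X" "t \<le> L" for r t L X
  proof
    assume avoid: "X \<inter> block m r = {}"
    have trace: "set_decode (set_encode (X \<inter> {..<t})) = X \<inter> {..<t}" by simp
    have "set_encode (X \<inter> {..<t}) < 2 ^ t"
      by (simp flip: set_decode_subset_iff)
    moreover have "T t (set_decode (set_encode (X \<inter> {..<t})))"
      using local_atD[OF tree_local[OF T], of "X \<inter> {..<t}" t X] tree_antimono[OF T that(2,3)]
      unfolding trace by auto
    ultimately show False
      using that(1) avoid unfolding wit_def avoids_block_iff by (metis IntD1 trace)
  qed
  \<comment> \<open>Only the least witness counts: a request listed twice would have the same block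
    twice and spoil independence.\<close>
  define act where "act i \<longleftrightarrow> wit (pfst i) (psnd i) \<and> (\<forall>t<psnd i. \<not> wit (pfst i) t)" for i
  define l where "l i = pfst (pfst (pfst i))" for i
  define \<tau> where "\<tau> i = set_decode (psnd (psnd (pfst i))) \<restriction> pfst (psnd (pfst i))" for i
  have "\<exists>d. \<forall>i. act i \<longrightarrow> K U (\<tau> i) \<le> enat (l i + d)"
  proof (rule K_le_weight)
    show "dec {} act" unfolding act_def by (intro recf_intros dec_comp2[OF dec_wit])
    show "recf {} l" unfolding l_def by (intro recf_intros)
    show "recf {} (\<lambda>i. bitstring_code (\<tau> i))" unfolding \<tau>_def by (intro recf_intros)
    show "(\<Sum>i\<in>{i. i < n \<and> act i}. 1 / 2 ^ l i) \<le> (2 ^ (g + m) :: real)" for n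
    proof -
      define I where "I = {i. i < n \<and> act i}"
      define L where "L = Max (insert 0 (psnd ` I))"
      have "finite I" by (simp add: I_def)
      then have L: "psnd i \<le> L" if "i \<in> I" for i
        unfolding L_def using that by (intro Max_ge) auto
      have "(\<Sum>i\<in>I. 1 / 2 ^ card (block m (pfst i))) \<le> real g"
      proof (rule weight_of_missed_blocks[OF \<open>finite I\<close>])
        show "block m (pfst i) \<subseteq> {..<L}" if "i \<in> I" for i
          using that L[OF that] unfolding I_def act_def wit_def block_subset_iff
          by (auto intro: less_le_trans)
        show "block m (pfst i) \<inter> block m (pfst j) = {}" if "i \<in> I" "j \<in> I" "i \<noteq> j" for i j
        proof (rule block_disjoint)
          have "psnd i = psnd j" if "pfst i = pfst j"
          proof (rule ccontr)
            assume "psnd i \<noteq> psnd j"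
            then have "psnd i < psnd j \<or> psnd j < psnd i" by linarith
            then show False
              using \<open>i \<in> I\<close> \<open>j \<in> I\<close> that unfolding I_def act_def by auto
          qed
          then show "pfst i \<noteq> pfst j"
            using \<open>i \<noteq> j\<close> by (metis prod.collapse prod_decode_inverse)
        qed
        have "prob L (T L) \<le> prob L (\<lambda>X. \<forall>i\<in>I. X \<inter> block m (pfst i) \<noteq> {})"
          using wit_missed L unfolding I_def act_def by (intro prob_mono) blast
        with meas[of L] show "1 / 2 ^ g \<le> prob L (\<lambda>X. \<forall>i\<in>I. X \<inter> block m (pfst i) \<noteq> {})"
          by linarith
      qed
      also have "(\<Sum>i\<in>I. 1 / 2 ^ card (block m (pfst i))) = (\<Sum>i\<in>I. 1 / 2 ^ l i) / (2 ^ m :: real)"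
        by (simp add: card_block l_def sum_divide_distrib power_add)
      finally have "(\<Sum>i\<in>I. 1 / 2 ^ l i) \<le> real g * 2 ^ m"
        by (simp add: field_simps)
      also have "\<dots> \<le> 2 ^ g * 2 ^ m"
        using of_nat_less_two_power[of g, where ?'a = real] by (intro mult_right_mono) auto
      finally show ?thesis by (simp add: I_def power_add)
    qed
  qed simp
  then obtain d where d: "\<And>i. act i \<Longrightarrow> K U (\<tau> i) \<le> enat (l i + d)" by blast
  have "K U (A \<restriction> n) \<le> K U (replicate n True) + enat d" for n
  proof (cases "K U (replicate n True) = \<infinity>")
    case False
    then obtain \<rho> where \<rho>: "U \<rho> = Some (replicate n True)" "K U (replicate n True) = enat (length \<rho>)"
      by (rule K_attained)
    define k where "k = length \<rho>"
    obtain v where v: "v < 2 ^ k" "\<rho> = set_decode v \<restriction> k"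
      unfolding k_def by (rule bitstring_eq_initial_segment)
    have U: "U (set_decode v \<restriction> k) = Some (UNIV \<restriction> n)" using \<rho>(1) v(2) by (simp add: initial_segment_UNIV)
    define r where "r = req A k v n"
    from missed[OF v(1) U] obtain t1 where t1: "\<And>X. T t1 X \<Longrightarrow> X \<inter> block m r \<noteq> {}"
      unfolding r_def by blast
    from describes_complete[OF U] obtain t2 where t2: "describes t2 k v (bitstring_code (UNIV \<restriction> n))" ..
    obtain t3 where t3: "block m r \<subseteq> {..<t3}"
      using finite_nat_iff_bounded finite_block by metis
    define t where "t = max t1 (max t2 t3)"
    have "\<exists>t. wit r t"
    proof
      have "\<forall>j<k + m. \<langle>r, j\<rangle> < t"
        using t3 unfolding block_subset_iff t_def by (auto simp: r_def req_def less_max_iff_disj)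
      moreover have "\<not> (T t X \<and> (\<forall>j<k + m. \<langle>r, j\<rangle> \<notin> X))" for X
        using t1[of X] tree_antimono[OF T, of t X t1] unfolding avoids_block_iff t_def
        by (auto simp: r_def req_def)
      moreover have "describes t k v (bitstring_code (UNIV \<restriction> n))"
        using describes_mono[OF t2] by (simp add: t_def)
      ultimately show "wit r t"
        unfolding wit_def using v(1) by (auto simp: r_def req_def)
    qed
    then have "act \<langle>r, LEAST t. wit r t\<rangle>"
      unfolding act_def using LeastI_ex[of "wit r"] not_less_Least by auto
    from d[OF this] have "K U (A \<restriction> n) \<le> enat (k + d)"
    proof -
      have "set_decode (set_encode (A \<inter> {..<n})) \<restriction> n = A \<restriction> n"
        by (simp add: initial_segment_eq_iff)
      then show ?thesis using d[OF \<open>act \<langle>r, LEAST t. wit r t\<rangle>\<close>] by (simp add: \<tau>_def l_def r_def req_def)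
    qed
    then show ?thesis by (simp add: \<rho>(2) k_def)
  qed simp
  then show ?thesis unfolding K_trivial_def by blast
qed

section \<open>A tree of random sets and the coding open sets\<close>

text \<open>Stage \<open>L\<close> of a universal test. The gap of two bits keeps its measure at
  most \<open>1 / 4\<close>, from which the initial bound \<open>1 / 2\<close> in
  \<open>positive_initial\<close> follows.\<close>

definition compressed :: "nat \<Rightarrow> nat set \<Rightarrow> bool" where
  "compressed L X \<longleftrightarrow> (\<exists>k<L. \<exists>v<2 ^ k. \<exists>n\<le>L. k + 2 \<le> n \<and> describes L k v (bitstring_code (X \<restriction> n)))"

text \<open>Stage \<open>L\<close> of the coding open set. Positions below \<open>L\<close> make it
  clopen, and only the finitely many correct requests seen by then consult \<open>A\<close>.\<close>

definition meets :: "nat set \<Rightarrow> nat \<Rightarrow> nat \<Rightarrow> nat set \<Rightarrow> bool" where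
  "meets A m L X \<longleftrightarrow> (\<exists>k<L. \<exists>v<2 ^ k. \<exists>n<L. describes L k v (bitstring_code (UNIV \<restriction> n)) \<and>
    (\<forall>j<k + m. \<langle>req A k v n, j\<rangle> < L \<and> \<langle>req A k v n, j\<rangle> \<notin> X))"

lemma local_compressed: "local_at L (compressed L)"
  unfolding local_at_def
proof (intro allI impI)
  fix X Y :: "nat set" assume "X \<inter> {..<L} = Y \<inter> {..<L}"
  then have "X \<restriction> n = Y \<restriction> n" if "n \<le> L" for n
    using that unfolding initial_segment_eq_iff by (rule Int_lessThan_mono)
  then show "compressed L X = compressed L Y" unfolding compressed_def by metis
qed

lemma compressed_mono: "compressed L X \<Longrightarrow> L \<le> L' \<Longrightarrow> compressed L' X"
  unfolding compressed_def by (meson describes_mono less_le_trans order_trans)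

lemma dec_compressed [recf_intros]:
  assumes "recf A L" "recf A w"
  shows "dec A (\<lambda>z. compressed (L z) (set_decode (w z)))"
  unfolding compressed_def
  by (intro recf_intros recf_comp[OF assms(1)] recf_comp[OF assms(2)] assms)

lemma Kraft_level:
  "(\<Sum>(k, v)\<in>{(k, v). k < L \<and> v < 2 ^ k \<and> U (set_decode v \<restriction> k) \<noteq> None}. 1 / 2 ^ k) \<le> (1::real)"
  and finite_Kraft_level: "finite {(k, v). k < L \<and> v < 2 ^ k \<and> U (set_decode v \<restriction> k) \<noteq> None}"
proof -
  have "{(k, v). k < L \<and> v < 2 ^ k \<and> U (set_decode v \<restriction> k) \<noteq> None} \<subseteq> Sigma {..<L} (\<lambda>k. {..<2 ^ k})"
    by auto
  then show fin: "finite {(k, v). k < L \<and> v < 2 ^ k \<and> U (set_decode v \<restriction> k) \<noteq> None}"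
    by (rule finite_subset) auto
  then show "(\<Sum>(k, v)\<in>{(k, v). k < L \<and> v < 2 ^ k \<and> U (set_decode v \<restriction> k) \<noteq> None}. 1 / 2 ^ k) \<le> (1::real)"
    by (rule Kraft_inequality) auto
qed

text \<open>A union bound: each halting string of length \<open>k\<close> describes one string, of
  length at least \<open>k + 2\<close>, and Kraft's inequality sums these up.\<close>

lemma prob_compressed: "prob L (compressed L) \<le> 1 / 4"
proof -
  define G where "G = {(k, v). k < L \<and> v < 2 ^ k \<and> U (set_decode v \<restriction> k) \<noteq> None}"
  define E where "E = (\<lambda>(k, v) X. \<exists>n\<le>L. k + 2 \<le> n \<and> U (set_decode v \<restriction> k) = Some (X \<restriction> n))"
  have "prob L (compressed L) \<le> prob L (\<lambda>X. \<exists>kv\<in>G. E kv X)"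
  proof (rule prob_mono)
    fix X assume "compressed L X"
    then obtain k v n where "k < L" "v < 2 ^ k" "n \<le> L" "k + 2 \<le> n"
      "describes L k v (bitstring_code (X \<restriction> n))"
      unfolding compressed_def by blast
    then show "\<exists>kv\<in>G. E kv X"
      using describes_sound unfolding G_def E_def by (intro bexI[of _ "(k, v)"]) auto
  qed
  also have "\<dots> \<le> (\<Sum>kv\<in>G. prob L (E kv))"
    using finite_Kraft_level unfolding G_def by (rule prob_bex_le)
  also have "\<dots> \<le> (\<Sum>(k, v)\<in>G. (1 / 2 ^ k) / 4)"
  proof (intro sum_mono, clarify)
    fix k v assume "(k, v) \<in> G"
    show "prob L (E (k, v)) \<le> (1 / 2 ^ k) / 4"
    proof (cases "\<exists>X. E (k, v) X")
      case True
      then obtain Y n where n: "n \<le> L" "k + 2 \<le> n" "U (set_decode v \<restriction> k) = Some (Y \<restriction> n)"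
        unfolding E_def by blast
      have "prob L (E (k, v)) \<le> prob L (\<lambda>X. X \<inter> {..<n} = Y \<inter> {..<n})"
      proof (rule prob_mono)
        fix X assume "E (k, v) X"
        then obtain n' where "U (set_decode v \<restriction> k) = Some (X \<restriction> n')" unfolding E_def by blast
        with n(3) have "X \<restriction> n' = Y \<restriction> n" by simp
        moreover from this have "n' = n" by (metis length_initial_segment)
        ultimately show "X \<inter> {..<n} = Y \<inter> {..<n}" by (simp add: initial_segment_eq_iff)
      qed
      also have "\<dots> = 1 / 2 ^ n" using prob_trace[of "{..<n}" L] n(1) by simp
      also have "\<dots> \<le> 1 / 2 ^ (k + 2)"
        using n(2) by (intro divide_left_mono power_increasing) auto
      finally show ?thesis by simp
    next
      case False
      then have "prob L (E (k, v)) = prob L (\<lambda>_. False)" by (intro prob_cong) auto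
      then show ?thesis by (simp add: prob_False)
    qed
  qed
  also have "\<dots> = (\<Sum>(k, v)\<in>G. 1 / 2 ^ k) / 4"
    by (simp add: sum_divide_distrib case_prod_unfold)
  also have "\<dots> \<le> 1 / 4"
    using Kraft_level unfolding G_def by simp
  finally show ?thesis .
qed

lemma Martin_Loef_random_if_never_compressed:
  assumes "\<And>L. \<not> compressed L R"
  shows "Martin_Loef_random U R"
  unfolding Martin_Loef_random_def
proof (intro exI allI, rule ccontr)
  fix n assume "\<not> enat n < K U (R \<restriction> n) + enat 2"
  then have le: "K U (R \<restriction> n) + enat 2 \<le> enat n" by simp
  then have "K U (R \<restriction> n) \<noteq> \<infinity>" by (intro notI) simp
  then obtain \<rho> where \<rho>: "U \<rho> = Some (R \<restriction> n)" "K U (R \<restriction> n) = enat (length \<rho>)"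
    by (rule K_attained)
  define k where "k = length \<rho>"
  obtain v where v: "v < 2 ^ k" "\<rho> = set_decode v \<restriction> k"
    unfolding k_def by (rule bitstring_eq_initial_segment)
  from describes_complete[of v k "R \<restriction> n"] \<rho>(1) v(2) obtain L
    where L: "describes L k v (bitstring_code (R \<restriction> n))" by auto
  have "k + 2 \<le> n" using le \<rho>(2) by (simp add: k_def)
  have "compressed (max L (Suc (max k n))) R"
    unfolding compressed_def using v(1) \<open>k + 2 \<le> n\<close> describes_mono[OF L]
    by (intro exI[of _ k] conjI exI[of _ v] exI[of _ n]) auto
  with assms show False by blast
qed

lemma local_meets: "local_at L (meets A m L)"
  unfolding local_at_def meets_def by (metis Int_iff lessThan_iff)

lemma meets_mono: "meets A m L X \<Longrightarrow> L \<le> L' \<Longrightarrow> meets A m L' X"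
  unfolding meets_def by (meson describes_mono less_le_trans)

lemma dec_meets:
  assumes "A \<le>\<^sub>T B" "recf B m" "recf B L" "recf B w"
  shows "dec B (\<lambda>z. meets A (m z) (L z) (set_decode (w z)))"
proof -
  have A: "dec B (\<lambda>x. x \<in> A)" using assms(1) by (simp add: turing_le_iff_dec)
  show ?thesis
    unfolding meets_def req_def
    by (intro recf_intros recf_restrict[OF A] recf_comp[OF assms(2)] recf_comp[OF assms(3)]
        recf_comp[OF assms(4)] assms)
qed

text \<open>A halting string determines \<open>n\<close>, hence a single block, avoided with
  probability \<open>1 / 2 ^ (k + m)\<close>; Kraft's inequality does the rest.\<close>

lemma prob_meets: "prob L (meets A m L) \<le> 1 / 2 ^ m"
proof -
  define G where "G = {(k, v). k < L \<and> v < 2 ^ k \<and> U (set_decode v \<restriction> k) \<noteq> None}"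
  define E where "E = (\<lambda>(k, v) X. \<exists>n. U (set_decode v \<restriction> k) = Some (UNIV \<restriction> n) \<and>
    block m (req A k v n) \<subseteq> {..<L} \<and> X \<inter> block m (req A k v n) = {})"
  have "prob L (meets A m L) \<le> prob L (\<lambda>X. \<exists>kv\<in>G. E kv X)"
  proof (rule prob_mono)
    fix X assume "meets A m L X"
    then obtain k v n where "k < L" "v < 2 ^ k" "describes L k v (bitstring_code (UNIV \<restriction> n))"
      "\<forall>j<k + m. \<langle>req A k v n, j\<rangle> < L \<and> \<langle>req A k v n, j\<rangle> \<notin> X"
      unfolding meets_def by blast
    then show "\<exists>kv\<in>G. E kv X"
      using describes_sound unfolding G_def E_def block_subset_iff avoids_block_iff
      by (intro bexI[of _ "(k, v)"]) (auto simp: req_def)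
  qed
  also have "\<dots> \<le> (\<Sum>kv\<in>G. prob L (E kv))"
    using finite_Kraft_level unfolding G_def by (rule prob_bex_le)
  also have "\<dots> \<le> (\<Sum>(k, v)\<in>G. (1 / 2 ^ k) / 2 ^ m)"
  proof (intro sum_mono, clarify)
    fix k v assume "(k, v) \<in> G"
    show "prob L (E (k, v)) \<le> (1 / 2 ^ k) / 2 ^ m"
    proof (cases "\<exists>X. E (k, v) X")
      case True
      then obtain n where n: "U (set_decode v \<restriction> k) = Some (UNIV \<restriction> n)" "block m (req A k v n) \<subseteq> {..<L}"
        unfolding E_def by blast
      have "prob L (E (k, v)) \<le> prob L (\<lambda>X. X \<inter> block m (req A k v n) = {})"
      proof (rule prob_mono)
        fix X assume "E (k, v) X"
        then obtain n' where "U (set_decode v \<restriction> k) = Some (UNIV \<restriction> n')" "X \<inter> block m (req A k v n') = {}"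
          unfolding E_def by blast
        moreover from this n(1) have "n' = n" by (metis length_initial_segment option.inject)
        ultimately show "X \<inter> block m (req A k v n) = {}" by simp
      qed
      also have "\<dots> = 1 / 2 ^ card (block m (req A k v n))" using n(2) by (intro prob_trace) auto
      finally show ?thesis by (simp add: card_block req_def power_add)
    next
      case False
      then have "prob L (E (k, v)) = prob L (\<lambda>_. False)" by (intro prob_cong) auto
      then show ?thesis by (simp add: prob_False)
    qed
  qed
  also have "\<dots> = (\<Sum>(k, v)\<in>G. 1 / 2 ^ k) / 2 ^ m"
    by (simp add: sum_divide_distrib case_prod_unfold)
  also have "\<dots> \<le> 1 / 2 ^ m"
    using Kraft_level unfolding G_def by (intro divide_right_mono) auto
  finally show ?thesis .
qed

text \<open>The stage depends on the description and the block but not on \<open>X\<close>, so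
  compactness can be applied to one clopen set.\<close>

lemma meets_if_avoids:
  assumes "v < 2 ^ k" "U (set_decode v \<restriction> k) = Some (UNIV \<restriction> n)"
  shows "\<exists>L. \<forall>X. X \<inter> block m (req A k v n) = {} \<longrightarrow> meets A m L X"
proof -
  from describes_complete[OF assms(2)] obtain t where t: "describes t k v (bitstring_code (UNIV \<restriction> n))" ..
  obtain b where b: "block m (req A k v n) \<subseteq> {..<b}"
    using finite_nat_iff_bounded finite_block by metis
  show ?thesis
  proof (intro exI allI impI)
    fix X assume X: "X \<inter> block m (req A k v n) = {}"
    define L where "L = max t (max b (Suc (max k n)))"
    have "k < L" "n < L" by (auto simp: L_def)
    have "describes L k v (bitstring_code (UNIV \<restriction> n))"
      using describes_mono[OF t] by (simp add: L_def)
    moreover have "\<forall>j<k + m. \<langle>req A k v n, j\<rangle> < L \<and> \<langle>req A k v n, j\<rangle> \<notin> X"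
      using X b unfolding block_subset_iff avoids_block_iff by (auto simp: L_def req_def less_max_iff_disj)
    ultimately show "meets A m (max t (max b (Suc (max k n)))) X"
      unfolding meets_def L_def[symmetric] using assms(1) \<open>k < L\<close> \<open>n < L\<close> by blast
  qed
qed

end

lemma jump_iff_hlt: "k \<in> jump X \<longleftrightarrow> (\<exists>L. \<exists>y<L. hlt X L k k y)"
proof
  assume "k \<in> jump X"
  then obtain p y where "k = prog_index p" "computes X p k y" by (auto simp: jump_def)
  with hlt_complete obtain L where "hlt X L k k y" by metis
  then show "\<exists>L. \<exists>y<L. hlt X L k k y" using hlt_less by blast
next
  assume "\<exists>L. \<exists>y<L. hlt X L k k y"
  then obtain L y where "hlt X L k k y" by blast
  then show "k \<in> jump X" by (rule hlt_sound) (auto simp: jump_def)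
qed

text \<open>The finite table of \<open>F\<close> is hard-wired as the constant \<open>c\<close>.
  This works even if \<open>F\<close> was defined from a noncomputable set such as
  \<open>A\<close>.\<close>

lemma dec_local:
  assumes "local_at s F" "recf A f"
  shows "dec A (\<lambda>x. F (set_decode (f x)))"
proof -
  define c where "c = set_encode {w. w < 2 ^ s \<and> F (set_decode w)}"
  have c: "set_decode c = {w. w < 2 ^ s \<and> F (set_decode w)}"
    unfolding c_def by (rule set_encode_inverse) simp
  have "F (set_decode w) \<longleftrightarrow> set_encode (set_decode w \<inter> {..<s}) \<in> set_decode c" for w
    using local_atD[OF assms(1), of "set_decode w \<inter> {..<s}" "set_decode w"]
    by (auto simp: c simp flip: set_decode_subset_iff)
  moreover have "set_encode (set_decode w \<inter> {..<s}) = (\<Sum>i<s. of_bool (i \<in> set_decode w) * 2 ^ i)" for w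
    by (rule set_encode_restrict)
  moreover have "dec A (\<lambda>x. (\<Sum>i<s. of_bool (i \<in> set_decode (f x)) * 2 ^ i) \<in> set_decode c)"
    by (intro recf_intros recf_comp[OF assms(2)] assms)
  ultimately show ?thesis by simp
qed

lemma dec_dense_core:
  assumes T: "dec A (\<lambda>z. T (pfst z) (set_decode (psnd z)))"
  shows "dec A (\<lambda>z. dense_core g T (pfst z) (set_decode (psnd z)))"
proof -
  have eq: "Y \<inter> {..<j} = X \<inter> {..<j} \<longleftrightarrow> (\<forall>i<j. i \<in> Y \<longleftrightarrow> i \<in> X)" for X Y :: "nat set" and j
    unfolding set_eq_iff Int_iff lessThan_iff by blast
  show ?thesis
    unfolding dense_core_def eq
    by (intro recf_intros dec_comp2[OF T])
qed

section \<open>Forcing conditions\<close>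

text \<open>
  A condition is a finite list of constraints: \<open>\<langle>0, \<langle>e, \<langle>x, y\<rangle>\<rangle>\<rangle>\<close> forbids that program \<open>e\<close> maps \<open>x\<close> to
  \<open>y\<close>, \<open>\<langle>1, e\<rangle>\<close> forbids \<open>e\<close> to enter the jump, \<open>\<langle>2, \<langle>L, w\<rangle>\<rangle>\<close> fixes the first \<open>L\<close> bits and \<open>\<langle>3, 0\<rangle>\<close> demands
  randomness.  A constraint fires when its violation is seen.
\<close>

context optimal_machine
begin

definition fires :: "nat \<Rightarrow> nat set \<Rightarrow> nat \<Rightarrow> bool" where
  "fires L X c \<longleftrightarrow>
    pfst c = 0 \<and> hlt X L (pfst (psnd c)) (pfst (psnd (psnd c))) (psnd (psnd (psnd c))) \<or>
    pfst c = 1 \<and> (\<exists>y<L. hlt X L (psnd c) (psnd c) y) \<or>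
    pfst c = 2 \<and> (\<exists>i<L. i < pfst (psnd c) \<and> (i \<in> X) \<noteq> (i \<in> set_decode (psnd (psnd c)))) \<or>
    pfst c = 3 \<and> compressed L X"

definition alive :: "nat \<Rightarrow> nat \<Rightarrow> nat set \<Rightarrow> bool" where
  "alive N L X \<longleftrightarrow> (\<forall>c\<in>set (list_decode N). \<not> fires L X c)"

definition ncons :: "nat \<Rightarrow> nat \<Rightarrow> nat" where
  "ncons c N = Suc \<langle>c, N\<rangle>"

lemma recf_ncons [recf_intros]: "recf B f \<Longrightarrow> recf B g \<Longrightarrow> recf B (\<lambda>x. ncons (f x) (g x))"
  unfolding ncons_def by (intro recf_intros)

lemma list_decode_ncons: "list_decode (ncons c N) = c # list_decode N"
  by (simp add: ncons_def)

lemma alive_ncons: "alive (ncons c N) L X \<longleftrightarrow> \<not> fires L X c \<and> alive N L X"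
  by (simp add: alive_def list_decode_ncons)

lemma fires_local:
  assumes XY: "X \<inter> {..<L} = Y \<inter> {..<L}"
  shows "fires L X c \<longleftrightarrow> fires L Y c"
proof -
  have "i \<in> X \<longleftrightarrow> i \<in> Y" if "i < L" for i
    using XY that by (metis Int_iff lessThan_iff)
  then show ?thesis
    unfolding fires_def hlt_cong[OF XY] local_atD[OF local_compressed XY] by meson
qed

lemma fires_mono: "fires L X c \<Longrightarrow> L \<le> L' \<Longrightarrow> fires L' X c"
  unfolding fires_def by (meson hlt_mono compressed_mono less_le_trans)

lemma tree_alive: "tree (alive N)"
proof (unfold tree_def local_at_def, intro conjI allI impI)
  show "alive N L X = alive N L Y" if "X \<inter> {..<L} = Y \<inter> {..<L}" for L X Y
    unfolding alive_def fires_local[OF that] ..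
  show "alive N L X" if "L \<le> L'" "alive N L' X" for L L' X
    using that(2) fires_mono[OF _ that(1)] unfolding alive_def by blast
qed

lemma dec_alive [recf_intros]:
  assumes "recf B N" "recf B L" "recf B w"
  shows "dec B (\<lambda>z. alive (N z) (L z) (set_decode (w z)))"
  unfolding alive_def fires_def
  by (intro recf_intros recf_comp[OF assms(1)] recf_comp[OF assms(2)] recf_comp[OF assms(3)] assms)

definition positive :: "nat \<Rightarrow> nat \<Rightarrow> bool" where
  "positive N q \<longleftrightarrow> (\<forall>L. 1 / 2 ^ q \<le> prob L (alive N L))"

text \<open>A measure bound for an effectively closed class is a universal statement over decidable
  ones, uniformly in the code of the condition.\<close>

lemma dec_positive:
  assumes "recf (jump {}) N" "recf (jump {}) q"
  shows "dec (jump {}) (\<lambda>x. positive (N x) (q x))"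
proof -
  have "dec {} (\<lambda>z. 1 / 2 ^ psnd (pfst z) \<le> prob (psnd z) (alive (pfst (pfst z)) (psnd z)))"
    by (intro recf_intros)
  from jump_empty_decides_all[where Q = "\<lambda>x L. 1 / 2 ^ psnd x \<le> prob L (alive (pfst x) L)", OF this]
  have "dec (jump {}) (\<lambda>x. positive (pfst x) (psnd x))"
    unfolding positive_def .
  from dec_comp2[OF this assms] show ?thesis .
qed

lemma positive_nonempty:
  assumes "positive N q"
  obtains X where "alive N L X"
proof -
  have "0 < prob L (alive N L)"
    using assms unfolding positive_def by (meson less_le_trans zero_less_divide_1_iff zero_less_numeral zero_less_power)
  then have "{X. X \<subseteq> {..<L} \<and> alive N L X} \<noteq> {}"
    unfolding prob_def by (metis card.empty div_0 less_irrefl of_nat_0)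
  with that show ?thesis by blast
qed

lemma positive_initial: "positive (ncons \<langle>3, 0\<rangle> 0) 1"
  unfolding positive_def
proof
  fix L
  have "alive (ncons \<langle>3, 0\<rangle> 0) L X \<longleftrightarrow> True \<and> \<not> compressed L X" for X
    by (simp add: alive_ncons) (simp add: alive_def fires_def)
  then have "prob L (alive (ncons \<langle>3, 0\<rangle> 0) L) = prob L (\<lambda>X. True \<and> \<not> compressed L X)"
    by (intro prob_cong)
  moreover have "1 - 1 / 4 \<le> prob L (\<lambda>X. True \<and> \<not> compressed L X)"
    using prob_diff_ge[of L "\<lambda>_. True" "compressed L"] prob_compressed[of L] by (simp add: prob_True)
  ultimately show "1 / 2 ^ 1 \<le> prob L (alive (ncons \<langle>3, 0\<rangle> 0) L)" by simp
qed

text \<open>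
  If the wrong value of \<^term>\<open>D\<close> could never be forced with a definite loss of measure, then the correct
  value would be recognisable as the only one taken on most of the tree.
\<close>

lemma force_difference:
  assumes pos: "positive N q" and "\<not> computable D"
  shows "\<exists>n. positive (ncons \<langle>0, \<langle>k, \<langle>n, of_bool (n \<in> D)\<rangle>\<rangle>\<rangle> N) (q + 2)"
proof (rule ccontr)
  assume neg: "\<not> ?thesis"
  define c where "c n b = ncons \<langle>0, \<langle>k, \<langle>n, b\<rangle>\<rangle>\<rangle> N" for n b
  have alive_c: "alive (c n b) L X \<longleftrightarrow> alive N L X \<and> \<not> hlt X L k n b" for n b L X
    by (auto simp: c_def alive_ncons fires_def)
  \<comment> \<open>\<open>t\<close> pairs a level with a value; it certifies that sets failing to
    map \<open>n\<close> to this value have become rare. Searching for such a \<open>t\<close> would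
    compute \<open>D\<close>.\<close>
  define P where "P n t \<longleftrightarrow> \<not> 1 / 2 ^ (q + 2) \<le> prob (pfst t) (alive (c n (psnd t)) (pfst t))" for n t
  from neg have "\<exists>L. P n \<langle>L, of_bool (n \<in> D)\<rangle>" for n
    unfolding positive_def P_def c_def by auto
  then have ex: "\<exists>t. P n t \<and> psnd t = of_bool (n \<in> D)" for n
    by (metis prod_encode_inverse snd_conv)
  have uniq: "psnd t = psnd t'" if "P n t" "P n t'" for n t t'
  proof (rule ccontr)
    assume ne: "psnd t \<noteq> psnd t'"
    define L where "L = max (pfst t) (pfst t')"
    have small: "prob L (alive (c n (psnd s)) L) < 1 / 2 ^ (q + 2)" if "P n s" "pfst s \<le> L" for s
      using that tree_prob_antimono[OF tree_alive, of "pfst s" "\<lambda>_. True" L "c n (psnd s)"]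
      unfolding P_def by (simp add: local_at_def)
    have "1 / 2 ^ q \<le> prob L (alive N L)" using pos unfolding positive_def by blast
    \<comment> \<open>No computation has two values, so every set of the tree escapes one of them;
      the two rare parts would cover the tree.\<close>
    also have "\<dots> \<le> prob L (\<lambda>X. alive (c n (psnd t)) L X \<or> alive (c n (psnd t')) L X)"
      using ne hlt_functional by (intro prob_mono) (auto simp: alive_c)
    also have "\<dots> \<le> prob L (alive (c n (psnd t)) L) + prob L (alive (c n (psnd t')) L)"
      by (rule prob_disj_le)
    also have "\<dots> < 1 / 2 ^ (q + 2) + 1 / 2 ^ (q + 2)"
      using small[OF that(1)] small[OF that(2)] by (simp add: L_def)
    finally show False by (simp add: field_simps)
  qed
  have "dec {} (\<lambda>z. P (pfst z) (psnd z))"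
    unfolding P_def c_def by (intro recf_intros)
  then have "recf {} (\<lambda>n. LEAST t. P n t)"
    by (rule recf_Least) (use ex in blast)
  then have "dec {} (\<lambda>n. psnd (LEAST t. P n t) = 1)"
    by (intro recf_intros)
  moreover have "psnd (LEAST t. P n t) = of_bool (n \<in> D)" for n
    using ex[of n] uniq LeastI_ex[of "P n"] by metis
  ultimately have "dec {} (\<lambda>n. n \<in> D)" by (simp del: One_nat_def)
  with assms(2) show False unfolding computable_def turing_le_iff_dec by blast
qed

text \<open>If forcing divergence leaves too little measure at some level \<open>s\<close>, at least
  half of the guaranteed measure has halted by stage \<open>s\<close>. This event is clopen, and it
  is imposed only from level \<open>s\<close> on, where it is local.\<close>

lemma decide_jump:
  assumes pos: "positive N q"
  obtains "positive (ncons \<langle>1, k\<rangle> N) (q + 1)"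
  | s where "\<And>L. 1 / 2 ^ (q + 1) \<le> prob L (\<lambda>X. alive N L X \<and> (s \<le> L \<longrightarrow> (\<exists>y<s. hlt X s k k y)))"
proof (cases "positive (ncons \<langle>1, k\<rangle> N) (q + 1)")
  case False
  then obtain s where s: "prob s (alive (ncons \<langle>1, k\<rangle> N) s) < 1 / 2 ^ (q + 1)"
    unfolding positive_def by (auto simp: not_le)
  have "1 / 2 ^ (q + 1) \<le> prob L (\<lambda>X. alive N L X \<and> (s \<le> L \<longrightarrow> (\<exists>y<s. hlt X s k k y)))" for L
  proof (cases "s \<le> L")
    case True
    have "prob L (\<lambda>X. alive N L X \<and> \<not> (\<exists>y<s. hlt X s k k y)) \<le> prob L (alive (ncons \<langle>1, k\<rangle> N) s)"
      using True tree_antimono[OF tree_alive[of N]]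
      by (intro prob_mono) (auto simp: alive_ncons fires_def)
    also have "\<dots> = prob s (alive (ncons \<langle>1, k\<rangle> N) s)"
      by (rule prob_local[OF tree_local[OF tree_alive] True])
    finally have "prob L (\<lambda>X. alive N L X \<and> \<not> (\<exists>y<s. hlt X s k k y)) < 1 / 2 ^ (q + 1)"
      using s by linarith
    moreover have "1 / 2 ^ q \<le> prob L (alive N L)"
      using pos by (simp add: positive_def)
    moreover have "1 / 2 ^ q = 2 * (1 / 2 ^ (q + 1) :: real)" by simp
    moreover have "prob L (\<lambda>X. alive N L X \<and> (s \<le> L \<longrightarrow> (\<exists>y<s. hlt X s k k y))) =
        prob L (\<lambda>X. alive N L X \<and> (\<exists>y<s. hlt X s k k y))"
      using True by (simp only: simp_thms)
    ultimately show ?thesis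
      using prob_split[of L "alive N L" "\<lambda>X. \<exists>y<s. hlt X s k k y"] by linarith
  next
    case False
    have "1 / 2 ^ (q + 1) \<le> (1 / 2 ^ q :: real)" by (simp add: field_simps)
    also have "\<dots> \<le> prob L (alive N L)" using pos by (simp add: positive_def)
    finally show ?thesis using False by simp
  qed
  then show ?thesis by (rule that(2))
qed (rule that(1))

text \<open>For \<open>b\<close> nonzero the stem itself shows convergence, as demanded by
  \<open>good\<close>; only divergence has to be kept as a constraint.\<close>

definition extend :: "nat set \<Rightarrow> nat \<Rightarrow> nat \<Rightarrow> nat \<Rightarrow> nat \<Rightarrow> nat \<Rightarrow> nat \<Rightarrow> nat" where
  "extend D k N n b L w =
    (let N' = ncons \<langle>0, \<langle>k, \<langle>n, of_bool (n \<in> D)\<rangle>\<rangle>\<rangle> N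
     in ncons \<langle>2, \<langle>L, w\<rangle>\<rangle> (if b = 0 then ncons \<langle>1, k\<rangle> N' else N'))"

text \<open>
  The five bits lost besides \<open>L\<close>: two for the difference to \<open>D\<close>, one for the jump, one for
  avoiding \<^const>\<open>meets\<close> until stage \<open>L\<close> and one for the dense core.
\<close>

definition good :: "nat set \<Rightarrow> nat set \<Rightarrow> nat \<Rightarrow> nat \<Rightarrow> nat \<Rightarrow> nat \<Rightarrow> nat \<Rightarrow> nat \<Rightarrow> nat \<Rightarrow> bool" where
  "good A D k N q n b L w \<longleftrightarrow> positive (extend D k N n b L w) (q + 5 + L) \<and> k < L \<and>
    meets A (q + 4) L (set_decode w) \<and> (\<forall>L'<L. \<not> meets A (q + 4) L' (set_decode w)) \<and>
    (k \<in> jump {} \<longrightarrow> (\<exists>y<L. hlt {} L k k y)) \<and>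
    (b \<noteq> 0 \<longrightarrow> (\<exists>y<L. hlt (set_decode w) L k k y))"

lemma good_exists:
  assumes pos: "positive N q" and D: "\<not> computable D" and A: "\<not> K_trivial U A"
  shows "\<exists>n b L w. good A D k N q n b L w"
proof -
  obtain n where n: "positive (ncons \<langle>0, \<langle>k, \<langle>n, of_bool (n \<in> D)\<rangle>\<rangle>\<rangle> N) (q + 2)"
    using force_difference[OF pos D] by blast
  define N1 where "N1 = ncons \<langle>0, \<langle>k, \<langle>n, of_bool (n \<in> D)\<rangle>\<rangle>\<rangle> N"
  define N2 where "N2 b = (if b = 0 then ncons \<langle>1, k\<rangle> N1 else N1)" for b :: nat
  define halted where "halted s X \<longleftrightarrow> (\<exists>y<s. hlt X s k k y)" for s X
  have halted_mono: "halted s X \<Longrightarrow> s \<le> s' \<Longrightarrow> halted s' X" for s s' X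
    unfolding halted_def using hlt_mono less_le_trans by meson
  have "\<exists>b s. \<forall>L. 1 / 2 ^ (q + 3) \<le> prob L (\<lambda>X. alive (N2 b) L X \<and> (s \<le> L \<longrightarrow> b \<noteq> 0 \<longrightarrow> halted s X))"
  proof (rule decide_jump[OF n, of k])
    assume "positive (ncons \<langle>1, k\<rangle> (ncons \<langle>0, \<langle>k, \<langle>n, of_bool (n \<in> D)\<rangle>\<rangle>\<rangle> N)) (q + 2 + 1)"
    then show ?thesis
      by (intro exI[of _ 0]) (simp add: N2_def N1_def positive_def numeral_3_eq_3)
  next
    fix s
    assume "\<And>L. 1 / 2 ^ (q + 2 + 1) \<le> prob L (\<lambda>X. alive (ncons \<langle>0, \<langle>k, \<langle>n, of_bool (n \<in> D)\<rangle>\<rangle>\<rangle> N) L X \<and>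
      (s \<le> L \<longrightarrow> (\<exists>y<s. hlt X s k k y)))"
    then show ?thesis
      by (intro exI[of _ 1] exI[of _ s]) (simp add: N2_def N1_def halted_def numeral_3_eq_3)
  qed
  then obtain b s1 where
    bs: "\<And>L. 1 / 2 ^ (q + 3) \<le> prob L (\<lambda>X. alive (N2 b) L X \<and> (s1 \<le> L \<longrightarrow> b \<noteq> 0 \<longrightarrow> halted s1 X))"
    by blast
  obtain s2 where s2: "k \<in> jump {} \<longrightarrow> halted s2 {}"
    using jump_iff_hlt[of k "{}"] unfolding halted_def by blast
  \<comment> \<open>Entry is delayed beyond \<open>s\<close>, so that its length exceeds
    \<open>k\<close>, bounds the halting time of \<open>k\<close> and lets the stem show
    convergence.\<close>
  define s where "s = max s1 (max s2 (Suc k))"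
  have s: "s1 \<le> s" "s2 \<le> s" "k < s" by (auto simp: s_def)
  define F where "F X \<longleftrightarrow> (b \<noteq> 0 \<longrightarrow> halted s1 X) \<and> \<not> meets A (q + 4) s X" for X
  have F_local: "local_at s F"
    unfolding local_at_def
  proof (intro allI impI)
    fix X Y :: "nat set" assume XY: "X \<inter> {..<s} = Y \<inter> {..<s}"
    show "F X = F Y"
      unfolding F_def halted_def hlt_cong[OF Int_lessThan_mono[OF XY s(1)]]
        local_atD[OF local_meets XY] ..
  qed
  define T where "T L X \<longleftrightarrow> alive (N2 b) L X \<and> (s \<le> L \<longrightarrow> F X)" for L X
  have T: "tree T"
    unfolding tree_def
  proof (intro conjI allI impI)
    show "local_at L (T L)" for L
    proof (cases "s \<le> L")
      case True
      then show ?thesis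
        unfolding T_def using tree_local[OF tree_alive] local_at_mono[OF F_local True]
        by (simp add: local_at_conj)
    next
      case False
      then show ?thesis unfolding T_def using tree_local[OF tree_alive] by simp
    qed
    show "T L X" if "L \<le> L'" "T L' X" for L L' X
      using that tree_antimono[OF tree_alive] unfolding T_def by fastforce
  qed
  \<comment> \<open>\<open>F\<close> mentions \<open>A\<close>, but as a clopen condition it enters
    only through a finite table.\<close>
  have dec_T: "dec {} (\<lambda>z. T (pfst z) (set_decode (psnd z)))"
    unfolding T_def by (intro recf_intros dec_local[OF F_local])
  \<comment> \<open>The parameter \<open>q + 4\<close> makes the removed stage at most half of the
    \<open>1 / 2 ^ (q + 3)\<close> left so far.\<close>
  have T_meas: "1 / 2 ^ (q + 4) \<le> prob L (T L)" for L
  proof (cases "s \<le> L")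
    case True
    have "prob L (\<lambda>X. (alive (N2 b) L X \<and> (s1 \<le> L \<longrightarrow> b \<noteq> 0 \<longrightarrow> halted s1 X)) \<and> \<not> meets A (q + 4) s X)
        \<le> prob L (T L)"
      using True s(1) by (intro prob_mono) (auto simp: T_def F_def)
    moreover have "prob L (meets A (q + 4) s) \<le> 1 / 2 ^ (q + 4)"
      using prob_local[OF local_meets True] prob_meets by simp
    moreover have "1 / 2 ^ (q + 3) = 2 * (1 / 2 ^ (q + 4) :: real)"
      by (simp add: numeral_eq_Suc)
    ultimately show ?thesis
      using bs[of L] prob_diff_ge[of L "\<lambda>X. alive (N2 b) L X \<and> (s1 \<le> L \<longrightarrow> b \<noteq> 0 \<longrightarrow> halted s1 X)"
          "meets A (q + 4) s"] by linarith
  next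
    case False
    have "1 / 2 ^ (q + 4) \<le> (1 / 2 ^ (q + 3) :: real)" by (simp add: numeral_eq_Suc field_simps)
    also have "\<dots> \<le> prob L (T L)"
      using False by (intro order_trans[OF bs[of L]] prob_mono) (auto simp: T_def)
    finally show ?thesis .
  qed
  define Q where "Q = dense_core (q + 5) T"
  have Q: "tree Q" unfolding Q_def by (rule tree_dense_core[OF T])
  have "1 / 2 ^ (q + 5) \<le> prob L (Q L)" for L
    using prob_dense_core[where T = T and L = L, OF T_meas] by (simp add: Q_def numeral_eq_Suc)
  \<comment> \<open>Contraposition: as \<open>A\<close> is not \<open>K\<close>-trivial, some
    correct request has its block avoided at every level of the dense core.\<close>
  from K_trivial_if_requests_missed[OF Q _ this, of "q + 4" A] A
  obtain k' v n' where kv: "v < 2 ^ k'" "U (set_decode v \<restriction> k') = Some (UNIV \<restriction> n')"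
    and hit: "\<And>t. \<exists>X. Q t X \<and> X \<inter> block (q + 4) (req A k' v n') = {}"
    using dec_dense_core[OF dec_T] unfolding Q_def by blast
  obtain L1 where L1: "\<And>X. X \<inter> block (q + 4) (req A k' v n') = {} \<Longrightarrow> meets A (q + 4) L1 X"
    using meets_if_avoids[OF kv] by blast
  define L0 where "L0 = max s L1"
  have L0: "s \<le> L0" "L1 \<le> L0" by (auto simp: L0_def)
  have "\<exists>X. Q L X \<and> meets A (q + 4) L0 X" for L
    using hit[of L] L1 meets_mono[OF _ L0(2)] by blast
  with Q local_meets obtain V where V: "V \<subseteq> {..<L0}" "meets A (q + 4) L0 V"
    and V_ext: "\<And>L. \<exists>X. X \<inter> {..<L0} = V \<and> Q L X"
    by (rule tree_compactness) auto
  define L where "L = (LEAST L. meets A (q + 4) L V)"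
  have L: "meets A (q + 4) L V" "L \<le> L0" "\<And>L'. L' < L \<Longrightarrow> \<not> meets A (q + 4) L' V"
    unfolding L_def using V(2) by (auto intro: LeastI Least_le dest: not_less_Least)
  \<comment> \<open>\<open>V\<close> may have elements from \<open>L\<close> on; the constraint
    fixes only the bits below \<open>L\<close>, the first entry, and these already decide
    \<open>meets\<close> at \<open>L\<close>.\<close>
  define w where "w = set_encode V"
  have w: "set_decode w = V" unfolding w_def using V(1) finite_subset by (intro set_encode_inverse) blast
  have "F V"
  proof -
    from V_ext[of L0] obtain X where X: "X \<inter> {..<L0} = V" "Q L0 X" by blast
    then have "F X" using L0(1) by (simp add: Q_def dense_core_def T_def)
    moreover have "X \<inter> {..<s} = V \<inter> {..<s}"
      using Int_lessThan_mono[OF _ L0(1), of X V] X(1) V(1) by blast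
    ultimately show "F V" using local_atD[OF F_local] by blast
  qed
  have "s < L"
    using \<open>F V\<close> meets_mono[OF L(1)] unfolding F_def by (meson not_le)
  have ext: "alive (extend D k N n b L w) L' X \<longleftrightarrow> alive (N2 b) L' X \<and> (\<forall>i<L'. i < L \<longrightarrow> (i \<in> X \<longleftrightarrow> i \<in> V))" for L' X
    by (auto simp: extend_def Let_def N2_def N1_def alive_ncons fires_def w)
  have "1 / 2 ^ (q + 5 + L) \<le> prob L' (alive (extend D k N n b L w) L')" for L'
  proof -
    define M where "M = max L0 L'"
    from V_ext[of M] obtain X where X: "X \<inter> {..<L0} = V" "Q M X" by blast
    have XV: "i \<in> X \<longleftrightarrow> i \<in> V" if "i < L" for i using X(1) L(2) that by auto
    \<comment> \<open>The density clause with \<open>j = L\<close>.\<close>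
    have "1 / 2 ^ (q + 5 + L) \<le> prob M (\<lambda>Y. Y \<inter> {..<L} = X \<inter> {..<L} \<and> T M Y)"
      using X(2) L(2) unfolding Q_def dense_core_def M_def by simp
    also have "\<dots> \<le> prob M (alive (extend D k N n b L w) M)"
    proof (rule prob_mono)
      fix Y assume Y: "Y \<inter> {..<L} = X \<inter> {..<L} \<and> T M Y"
      have "i \<in> Y \<longleftrightarrow> i \<in> V" if "i < L" for i
        using Y XV[OF that] that by (metis Int_iff lessThan_iff)
      with Y show "alive (extend D k N n b L w) M Y" unfolding ext T_def by blast
    qed
    also have "\<dots> \<le> prob L' (alive (extend D k N n b L w) L')"
      using tree_prob_antimono[OF tree_alive, of L' "\<lambda>_. True" M] by (simp add: local_at_def M_def)
    finally show ?thesis .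
  qed
  then have "positive (extend D k N n b L w) (q + 5 + L)" by (simp add: positive_def)
  moreover have "k \<in> jump {} \<longrightarrow> (\<exists>y<L. hlt {} L k k y)"
    using s2 halted_mono[of s2 "{}" L] s(2) \<open>s < L\<close> unfolding halted_def by auto
  moreover have "b \<noteq> 0 \<longrightarrow> (\<exists>y<L. hlt V L k k y)"
    using \<open>F V\<close> halted_mono[of s1 V L] s(1) \<open>s < L\<close> unfolding F_def halted_def by auto
  ultimately have "good A D k N q n b L w"
    unfolding good_def w using L s(3) \<open>s < L\<close> by auto
  then show ?thesis by blast
qed

end

section \<open>The construction\<close>

lemma (in optimal_machine) meets_antimono_parameter: "meets A m L X \<Longrightarrow> m' \<le> m \<Longrightarrow> meets A m' L X"
  unfolding meets_def by (meson add_left_mono less_le_trans)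

locale cupping = optimal_machine U pU for U pU +
  fixes A D :: "nat set"
  assumes A_le: "A \<le>\<^sub>T jump {}" and D_le: "D \<le>\<^sub>T jump {}"
    and A_not_trivial: "\<not> K_trivial U A" and D_not_computable: "\<not> computable D"
begin

abbreviation z_n :: "nat \<Rightarrow> nat" where "z_n z \<equiv> pfst z"
abbreviation z_b :: "nat \<Rightarrow> nat" where "z_b z \<equiv> pfst (psnd z)"
abbreviation z_L :: "nat \<Rightarrow> nat" where "z_L z \<equiv> pfst (psnd (psnd z))"
abbreviation z_w :: "nat \<Rightarrow> nat" where "z_w z \<equiv> psnd (psnd (psnd z))"

text \<open>The implication makes the search total on all inputs, as \<open>recf_Least\<close>
  requires; along the construction its premise always holds.\<close>

definition choice :: "nat \<Rightarrow> nat \<Rightarrow> nat" where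
  "choice k s = (LEAST z. positive (pfst s) (psnd s) \<longrightarrow>
    good A D k (pfst s) (psnd s) (z_n z) (z_b z) (z_L z) (z_w z))"

primrec state :: "nat \<Rightarrow> nat" where
  "state 0 = \<langle>ncons \<langle>3, 0\<rangle> 0, 1\<rangle>"
| "state (Suc k) = (let s = state k; z = choice k s in
    \<langle>extend D k (pfst s) (z_n z) (z_b z) (z_L z) (z_w z), psnd s + 5 + z_L z\<rangle>)"

abbreviation cons_at :: "nat \<Rightarrow> nat" where "cons_at k \<equiv> pfst (state k)"
abbreviation loss_at :: "nat \<Rightarrow> nat" where "loss_at k \<equiv> psnd (state k)"
abbreviation arg_at :: "nat \<Rightarrow> nat" where "arg_at k \<equiv> z_n (choice k (state k))"
abbreviation bit_at :: "nat \<Rightarrow> nat" where "bit_at k \<equiv> z_b (choice k (state k))"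
abbreviation len_at :: "nat \<Rightarrow> nat" where "len_at k \<equiv> z_L (choice k (state k))"
abbreviation stem_at :: "nat \<Rightarrow> nat" where "stem_at k \<equiv> z_w (choice k (state k))"

text \<open>By \<^term>\<open>k < len_at k\<close>, bit \<open>i\<close> is already decided by the stem of stage \<open>i\<close>.\<close>

definition R :: "nat set" where
  "R = {i. i \<in> set_decode (stem_at i)}"

lemma recf_extend:
  assumes "recf (jump {}) k" "recf (jump {}) N" "recf (jump {}) n" "recf (jump {}) b"
    "recf (jump {}) L" "recf (jump {}) w"
  shows "recf (jump {}) (\<lambda>x. extend D (k x) (N x) (n x) (b x) (L x) (w x))"
proof -
  have D: "dec (jump {}) (\<lambda>x. x \<in> D)" using D_le by (simp add: turing_le_iff_dec)
  show ?thesis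
    unfolding extend_def Let_def by (intro recf_intros dec_comp[OF D] assms)
qed

lemma ex_good:
  "\<exists>z. positive N q \<longrightarrow> good A D k N q (z_n z) (z_b z) (z_L z) (z_w z)"
proof (cases "positive N q")
  case True
  from good_exists[OF True D_not_computable A_not_trivial]
  obtain n b L w where "good A D k N q n b L w" by blast
  then show ?thesis by (intro exI[of _ "\<langle>n, \<langle>b, \<langle>L, w\<rangle>\<rangle>\<rangle>"]) simp
qed simp

text \<open>Each clause of \<open>good\<close> is decidable in the halting problem,
  \<open>meets\<close> because \<open>A\<close> is; a plain search therefore suffices.\<close>

lemma recf_choice:
  assumes "recf (jump {}) k" "recf (jump {}) s"
  shows "recf (jump {}) (\<lambda>x. choice (k x) (s x))"
proof -
  have "dec (jump {}) (\<lambda>z. positive (pfst (psnd (pfst z))) (psnd (psnd (pfst z))) \<longrightarrow>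
    good A D (pfst (pfst z)) (pfst (psnd (pfst z))) (psnd (psnd (pfst z)))
      (z_n (psnd z)) (z_b (psnd z)) (z_L (psnd z)) (z_w (psnd z)))"
    unfolding good_def
    by (intro recf_intros dec_positive recf_extend dec_meets[OF A_le] dec_oracle)
  from recf_Least[where P = "\<lambda>x z. positive (pfst (psnd x)) (psnd (psnd x)) \<longrightarrow>
    good A D (pfst x) (pfst (psnd x)) (psnd (psnd x)) (z_n z) (z_b z) (z_L z) (z_w z)", OF this ex_good]
  have "recf (jump {}) (\<lambda>x. choice (pfst x) (psnd x))"
    unfolding choice_def .
  from recf_comp2[OF this assms] show ?thesis .
qed

lemma recf_state: "recf (jump {}) f \<Longrightarrow> recf (jump {}) (\<lambda>x. state (f x))"
proof -
  have "state k = rec_nat \<langle>ncons \<langle>3, 0\<rangle> 0, 1\<rangle> (\<lambda>k s. \<langle>extend D k (pfst s) (z_n (choice k s))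
      (z_b (choice k s)) (z_L (choice k s)) (z_w (choice k s)), psnd s + 5 + z_L (choice k s)\<rangle>) k" for k
    by (induction k) (simp_all add: Let_def)
  moreover assume "recf (jump {}) f"
  then have "recf (jump {}) (\<lambda>x. rec_nat \<langle>ncons \<langle>3, 0\<rangle> 0, 1\<rangle> (\<lambda>k s. \<langle>extend D k (pfst s) (z_n (choice k s))
      (z_b (choice k s)) (z_L (choice k s)) (z_w (choice k s)), psnd s + 5 + z_L (choice k s)\<rangle>) (f x))"
    by (intro recf_intros recf_extend recf_choice)
  ultimately show ?thesis by simp
qed

section \<open>Verification of the construction\<close>

lemma positive_state: "positive (cons_at k) (loss_at k)"
  and good_choice: "good A D k (cons_at k) (loss_at k) (arg_at k) (bit_at k) (len_at k) (stem_at k)"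
proof -
  have good: "good A D k (pfst s) (psnd s) (z_n (choice k s)) (z_b (choice k s)) (z_L (choice k s)) (z_w (choice k s))"
    if "positive (pfst s) (psnd s)" for k s
    using that LeastI_ex[OF ex_good[of "pfst s" "psnd s" k]] unfolding choice_def by blast
  show pos: "positive (cons_at k) (loss_at k)" for k
  proof (induction k)
    case 0
    show ?case using positive_initial by simp
  next
    case (Suc k)
    from good[OF this, of k] show ?case by (simp add: good_def Let_def)
  qed
  show "good A D k (cons_at k) (loss_at k) (arg_at k) (bit_at k) (len_at k) (stem_at k)"
    using good pos by blast
qed

lemma cons_at_Suc:
  "cons_at (Suc k) = extend D k (cons_at k) (arg_at k) (bit_at k) (len_at k) (stem_at k)"
  by (simp add: Let_def)

lemma loss_at_Suc: "loss_at (Suc k) = loss_at k + 5 + len_at k"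
  by (simp add: Let_def)

lemma len_at_gt: "k < len_at k"
  using good_choice[of k] by (simp add: good_def)

lemma loss_at_ge: "k \<le> loss_at k"
  by (induction k) (simp_all add: loss_at_Suc del: state.simps(2))

lemma constraints_mono: "j \<le> k \<Longrightarrow> set (list_decode (cons_at j)) \<subseteq> set (list_decode (cons_at k))"
proof (induction k rule: dec_induct)
  case (step k)
  moreover have "set (list_decode (cons_at k)) \<subseteq> set (list_decode (cons_at (Suc k)))"
    unfolding cons_at_Suc by (auto simp: extend_def Let_def list_decode_ncons)
  ultimately show ?case by blast
qed simp

lemma constraint_stem: "\<langle>2, \<langle>len_at k, stem_at k\<rangle>\<rangle> \<in> set (list_decode (cons_at (Suc k)))"
  unfolding cons_at_Suc by (simp add: extend_def Let_def list_decode_ncons)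

lemma constraint_value:
  "\<langle>0, \<langle>k, \<langle>arg_at k, of_bool (arg_at k \<in> D)\<rangle>\<rangle>\<rangle> \<in> set (list_decode (cons_at (Suc k)))"
  unfolding cons_at_Suc by (simp add: extend_def Let_def list_decode_ncons)

lemma constraint_jump: "bit_at k = 0 \<Longrightarrow> \<langle>1, k\<rangle> \<in> set (list_decode (cons_at (Suc k)))"
  unfolding cons_at_Suc by (simp add: extend_def Let_def list_decode_ncons)

text \<open>Stems of different stages agree because a positive condition has a living set, which
  obeys all stem constraints collected so far.\<close>

lemma R_stem:
  assumes "i < len_at k"
  shows "i \<in> R \<longleftrightarrow> i \<in> set_decode (stem_at k)"
proof -
  obtain X where X: "alive (cons_at (Suc (max i k))) (Suc i) X"
    by (rule positive_nonempty[OF positive_state])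
  have "i \<in> X \<longleftrightarrow> i \<in> set_decode (stem_at j)" if "i < len_at j" "j \<le> max i k" for j
  proof -
    have "\<langle>2, \<langle>len_at j, stem_at j\<rangle>\<rangle> \<in> set (list_decode (cons_at (Suc (max i k))))"
      using constraint_stem[of j] constraints_mono[of "Suc j" "Suc (max i k)"] that(2) by blast
    with X have "\<not> fires (Suc i) X \<langle>2, \<langle>len_at j, stem_at j\<rangle>\<rangle>" unfolding alive_def by blast
    with that(1) show ?thesis by (auto simp: fires_def)
  qed
  from this[of i] this[of k] assms len_at_gt[of i] show ?thesis by (simp add: R_def)
qed

lemma R_trace: "L \<le> len_at k \<Longrightarrow> R \<inter> {..<L} = set_decode (stem_at k) \<inter> {..<L}"
  by (intro set_eqI) (meson Int_iff R_stem lessThan_iff less_le_trans)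

text \<open>A living set of a late condition coincides with \<open>R\<close> up to a stem longer
  than \<open>L\<close>, and being alive at level \<open>L\<close> is local.\<close>

lemma alive_R: "alive (cons_at j) L R"
proof -
  define k where "k = max j L"
  have k: "j \<le> k" "L \<le> len_at k" using len_at_gt[of k] by (auto simp: k_def)
  obtain X where X: "alive (cons_at (Suc k)) (len_at k) X"
    by (rule positive_nonempty[OF positive_state])
  have "\<not> fires (len_at k) X \<langle>2, \<langle>len_at k, stem_at k\<rangle>\<rangle>"
    using X constraint_stem[of k] unfolding alive_def by blast
  then have "X \<inter> {..<len_at k} = set_decode (stem_at k) \<inter> {..<len_at k}"
    by (auto simp: fires_def)
  then have "alive (cons_at (Suc k)) (len_at k) R"
    using X local_atD[OF tree_local[OF tree_alive]] R_trace[of "len_at k" k] by (metis order_refl)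
  then have "alive (cons_at (Suc k)) L R"
    by (rule tree_antimono[OF tree_alive _ k(2)])
  then show ?thesis
    using constraints_mono[of j "Suc k"] k(1) unfolding alive_def by auto
qed

lemma R_random: "Martin_Loef_random U R"
proof (rule Martin_Loef_random_if_never_compressed)
  show "\<not> compressed L R" for L
    using alive_R[of 0 L] by (simp add: alive_def list_decode_ncons fires_def)
qed

lemma D_not_le_R: "\<not> D \<le>\<^sub>T R"
proof
  assume "D \<le>\<^sub>T R"
  then obtain p where p: "\<And>n. computes R p n (of_bool (n \<in> D))"
    by (auto simp: turing_le_def)
  define k where "k = prog_index p"
  from hlt_complete[OF p[of "arg_at k"]] obtain L where "hlt R L k (arg_at k) (of_bool (arg_at k \<in> D))"
    unfolding k_def by blast
  then have "fires L R \<langle>0, \<langle>k, \<langle>arg_at k, of_bool (arg_at k \<in> D)\<rangle>\<rangle>\<rangle>"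
    by (simp add: fires_def)
  with alive_R[of "Suc k" L] constraint_value[of k] show False
    unfolding alive_def by blast
qed

text \<open>The jump is decided during the construction: divergence is a constraint obeyed by
  \<open>R\<close>, convergence is visible on a stem of \<open>R\<close>.\<close>

lemma jump_R_iff: "k \<in> jump R \<longleftrightarrow> bit_at k \<noteq> 0"
proof
  assume "k \<in> jump R"
  then obtain L where "\<exists>y<L. hlt R L k k y" unfolding jump_iff_hlt by blast
  then have "fires L R \<langle>1, k\<rangle>" by (simp add: fires_def)
  with alive_R[of "Suc k" L] constraint_jump[of k] show "bit_at k \<noteq> 0"
    unfolding alive_def by blast
next
  assume "bit_at k \<noteq> 0"
  then have "\<exists>y<len_at k. hlt (set_decode (stem_at k)) (len_at k) k k y"
    using good_choice[of k] unfolding good_def by blast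
  then show "k \<in> jump R"
    unfolding jump_iff_hlt using hlt_cong[OF R_trace[OF order_refl, of k]] by blast
qed

lemma R_low: "low R"
  unfolding low_def turing_le_iff_dec jump_R_iff
  by (intro recf_intros recf_choice recf_state)

lemma R_le: "R \<le>\<^sub>T jump {}"
  unfolding turing_le_iff_dec R_def mem_Collect_eq
  by (intro recf_intros recf_choice recf_state)

text \<open>The decoding step: \<open>R\<close> agrees with the stem below \<open>len_at k\<close>,
  and earlier stages of the coding set look only at these bits. Nothing of the condition but its
  loss is used.\<close>

lemma len_at_decode: "len_at k = (LEAST L. meets A (loss_at k + 4) L R)"
proof (rule Least_equality[symmetric])
  note good = good_choice[of k, unfolded good_def]
  show "meets A (loss_at k + 4) (len_at k) R"
    using good local_atD[OF local_meets R_trace[OF order_refl, of k]] by blast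
  show "len_at k \<le> L" if "meets A (loss_at k + 4) L R" for L
  proof (rule ccontr)
    assume "\<not> len_at k \<le> L"
    then have L: "L < len_at k" by simp
    with good have "\<not> meets A (loss_at k + 4) L (set_decode (stem_at k))" by blast
    then show False
      using that local_atD[OF local_meets R_trace[of L k]] L by auto
  qed
qed

text \<open>The decoder's search must terminate for every parameter, not just for losses that occur;
  losses are unbounded and the coding sets shrink with the parameter.\<close>

lemma R_meets_all: "\<exists>L. meets A m L R"
proof -
  have "meets A (loss_at m + 4) (len_at m) R"
    using good_choice[of m, unfolded good_def] local_atD[OF local_meets R_trace[OF order_refl, of m]]
    by blast
  moreover have "m \<le> loss_at m + 4" using loss_at_ge[of m] by simp
  ultimately show ?thesis using meets_antimono_parameter by blast
qed

lemma halting_problem_le_join: "jump {} \<le>\<^sub>T A \<oplus>\<^sub>T R"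
proof -
  let ?B = "A \<oplus>\<^sub>T R"
  define entry where "entry q = (LEAST L. meets A (q + 4) L R)" for q
  have R: "dec ?B (\<lambda>x. x \<in> R)" using turing_le_join2 by (simp add: turing_le_iff_dec)
  have "meets A m L R \<longleftrightarrow> meets A m L (set_decode (set_encode (R \<inter> {..<L})))" for m L
    by (rule local_atD[OF local_meets]) simp
  moreover have "dec ?B (\<lambda>z. meets A (pfst z + 4) (psnd z) (set_decode (set_encode (R \<inter> {..<psnd z}))))"
    by (intro dec_meets[OF turing_le_join1] recf_intros recf_restrict[OF R])
  ultimately have "dec ?B (\<lambda>z. meets A (pfst z + 4) (psnd z) R)" by simp
  from recf_Least[where P = "\<lambda>q L. meets A (q + 4) L R", OF this R_meets_all]
  have entry: "recf ?B entry" unfolding entry_def .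
  \<comment> \<open>The decoder replays the losses from the initial value 1, without the choices for
    \<open>D\<close> and the jump.\<close>
  have "loss_at k = rec_nat 1 (\<lambda>_ q. q + 5 + entry q) k" for k
    by (induction k) (simp_all add: loss_at_Suc len_at_decode entry_def del: state.simps(2))
  moreover have "recf ?B (\<lambda>k. rec_nat 1 (\<lambda>_ q. q + 5 + entry q) k)"
    by (intro recf_intros recf_comp[OF entry])
  ultimately have "recf ?B (\<lambda>k. loss_at k)" by simp
  then have len: "recf ?B (\<lambda>k. len_at k)"
    unfolding len_at_decode entry_def[symmetric] by (rule recf_comp[OF entry])
  \<comment> \<open>Stage \<open>len_at k\<close> was chosen late enough for a halting computation
    of \<open>k\<close> to be visible.\<close>
  have "k \<in> jump {} \<longleftrightarrow> (\<exists>y<len_at k. hlt {} (len_at k) k k y)" for k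
    using good_choice[of k] unfolding good_def by (metis jump_iff_hlt)
  moreover have "dec ?B (\<lambda>k. \<exists>y<len_at k. hlt {} (len_at k) k k y)"
    by (intro recf_intros recf_comp[OF len] len)
  ultimately show ?thesis by (simp add: turing_le_iff_dec)
qed

end

theorem theorem3p3:
  fixes U :: "bitstring \<Rightarrow> bitstring option" and A D :: "nat set"
  assumes "optimal_prefix_free_machine U"
    and "A <\<^sub>T jump {}"
    and "\<not> K_trivial U A"
    and "D \<le>\<^sub>T jump {}"
    and "\<not> computable D"
  shows "\<exists>R. Martin_Loef_random U R \<and> \<not> D \<le>\<^sub>T R \<and> low R \<and> A \<oplus>\<^sub>T R \<equiv>\<^sub>T jump {}"
proof -
  from assms(1) obtain pU where
    "\<And>\<sigma> y. computes {} pU (bitstring_code \<sigma>) y \<longleftrightarrow> (\<exists>\<tau>. U \<sigma> = Some \<tau> \<and> y = bitstring_code \<tau>)"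
    unfolding optimal_prefix_free_machine_def prefix_free_machine_def partial_computable_def by blast
  moreover have "A \<le>\<^sub>T jump {}" using assms(2) by (simp add: turing_less_def)
  ultimately interpret cupping U pU A D
    using assms by unfold_locales
  show ?thesis
    using R_random D_not_le_R R_low turing_join_le[OF A_le R_le] halting_problem_le_join
    unfolding turing_equiv_def by blast
qed

end
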